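(* Let $f$ be a transcendental entire function with $F(f)\neq\emptyset$ and $\lambda(f)<1/2$. If there exist positive constants $M_1$, $D_1>1$ and $D_2>1$ with $D_1>D_2^2$ such that $$[M_1,\infty)\subset\{r>0:\ \log M(D_1r,f)<D_2\log M(r,f)\},$$ then $F(f)$ is uniformly bounded, i.e. $B_2(f)<\infty$.
   Context: For a transcendental entire function $f$, the Fatou set $F(f)$ is the set of $z\in\mathbb C$ such that the sequence of iterates $\{f^n\}_{n\ge1}$ is normal (in the sense of Montel, with the constant limit $\infty$ allowed) in some neighborhood of $z$. Write $M(r,f)=\max\{|f(z)|:|z|=r\}$; the order of $f$ is $\lambda(f)=\limsup_{r\to\infty}\frac{\log\log M(r,f)}{\log r}$. Define $$B_2(f)=\sup_U\frac{\sup_{z\in U}\log\log(|z|+30)}{\inf_{w\in U}\log(|w|+3)},$$ where $\sup_U$ is over all connected components $U$ of $F(f)$ (a term is $+\infty$ if $U$ is unbounded). $F(f)$ is called uniformly bounded if $B_2(f)<\infty$. *)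

theory Defs
  imports "HOL-Complex_Analysis.Complex_Analysis"
begin

definition transcendental_entire :: "(complex \<Rightarrow> complex) \<Rightarrow> bool" where
  "transcendental_entire f \<longleftrightarrow>
     f holomorphic_on UNIV \<and> \<not> (\<exists>p. \<forall>z. f z = poly p z)"

(* Montel normality, with the constant limit infinity allowed. *)
definition normal_family_on :: "(complex \<Rightarrow> complex) set \<Rightarrow> complex set \<Rightarrow> bool" where
  "normal_family_on H V \<longleftrightarrow>
     (\<forall>h :: nat \<Rightarrow> complex \<Rightarrow> complex. range h \<subseteq> H \<longrightarrow>
       (\<exists>k :: nat \<Rightarrow> nat. strict_mono k \<and>
         ((\<exists>g. \<forall>K. compact K \<and> K \<subseteq> V \<longrightarrow> uniform_limit K (\<lambda>n. h (k n)) g sequentially) \<or>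
          (\<forall>K. compact K \<and> K \<subseteq> V \<longrightarrow>
             (\<forall>R::real. \<forall>\<^sub>F n in sequentially. \<forall>z\<in>K. norm (h (k n) z) > R)))))"

definition fatou_set :: "(complex \<Rightarrow> complex) \<Rightarrow> complex set" where
  "fatou_set f = {z. \<exists>V. open V \<and> z \<in> V \<and> normal_family_on {f ^^ n |n. n \<ge> 1} V}"

(* For continuous f and r >= 0 the supremum is attained, the circle being compact. *)
definition max_modulus :: "real \<Rightarrow> (complex \<Rightarrow> complex) \<Rightarrow> real" where
  "max_modulus r f = (SUP z\<in>sphere 0 r. norm (f z))"

definition entire_order :: "(complex \<Rightarrow> complex) \<Rightarrow> ereal" where
  "entire_order f = Limsup at_top (\<lambda>r. ereal (ln (ln (max_modulus r f)) / ln r))"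

definition B2_term :: "complex set \<Rightarrow> ereal" where
  "B2_term U = (SUP z\<in>U. ereal (ln (ln (norm z + 30)))) / (INF w\<in>U. ereal (ln (norm w + 3)))"

definition B2 :: "(complex \<Rightarrow> complex) \<Rightarrow> ereal" where
  "B2 f = (SUP U\<in>components (fatou_set f). B2_term U)"

(* The arithmetic of ereal already yields the convention for unbounded components. *)
lemma B2_term_unbounded:
  assumes "\<not> bounded U"
  shows "B2_term U = \<infinity>"
proof -
  have ne: "U \<noteq> {}" using assms by auto
  have S: "(SUP z\<in>U. ereal (ln (ln (norm z + 30)))) = \<infinity>"
  proof (rule SUP_PInfty)
    fix n :: nat
    obtain z where z: "z \<in> U" "norm z > exp (exp (real n))"
      using assms unfolding bounded_iff by (meson not_le)
    have "exp (real n) \<le> ln (norm z + 30)"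
      using z by (subst ln_ge_iff) (auto intro: add_nonneg_pos)
    moreover from this have "0 < ln (norm z + 30)"
      using exp_gt_zero less_le_trans by blast
    ultimately have "real n \<le> ln (ln (norm z + 30))"
      by (subst ln_ge_iff) auto
    with z show "\<exists>z\<in>U. ereal (real n) \<le> ereal (ln (ln (norm z + 30)))" by auto
  qed
  obtain w where w: "w \<in> U" using ne by auto
  let ?I = "INF w\<in>U. ereal (ln (norm w + 3))"
  have "ereal (ln 3) \<le> ?I"
    by (intro INF_greatest) (simp add: ln_le_cancel_iff add_nonneg_pos)
  moreover have "?I \<le> ereal (ln (norm w + 3))" using w by (rule INF_lower)
  ultimately obtain c where c: "?I = ereal c" "ln 3 \<le> c"
    by (cases ?I) auto
  have "c > 0" using c(2) ln_gt_zero[of "3::real"] by linarith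
  then show ?thesis using S c unfolding B2_term_def by simp
qed

end

theory Submission
  imports Defs "HOL-Real_Asymp.Real_Asymp"
begin

text \<open>
  Write \<open>L t = ln (max_modulus (exp t) f)\<close>. The growth condition and \<open>D1 > D2\<^sup>2\<close> make \<open>f\<close> behave like
  a function of order less than 1/2, so on some circle near any large \<open>exp T\<close> the minimum modulus is at
  least \<open>exp (\<kappa> * L T)\<close> (maximum principle in a half plane after the substitution \<open>z = - w\<^sup>2\<close>). Where
  \<open>L\<close> grows slowly this is improved to \<open>exp ((1 - o(1)) * L T)\<close>, since the disc then has few zeros compared
  with \<open>L T\<close>; where \<open>L\<close> grows fast the constant \<open>\<kappa>\<close> does no harm. With Hadamard's three circles theorem this
  gives, for \<open>t \<le> T / 2\<close>, a minimum modulus of at least \<open>exp ((1 - T powr (-1/8)) * (T / t) * L t)\<close>, up to a constant.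

  If a component \<open>U\<close> of the Fatou set had points \<open>w\<close>, \<open>z\<close> with \<open>norm w \<le> exp t\<close> and \<open>norm z \<ge> exp (exp t)\<close>,
  then, starting from \<open>exp t \<ge> 4 * L t\<close>, every \<open>f ^^ n\<close> would map a compact connected set in \<open>U\<close> joining
  \<open>w\<close> to \<open>z\<close> to a set reaching modulus \<open>exp (2 * (L ^^ Suc n) t)\<close>, while \<open>(f ^^ n) w\<close> has modulus at most
  \<open>exp ((L ^^ n) t)\<close>. As \<open>L s / s\<close> tends to infinity, this contradicts Harnack's inequality for
  \<open>ln (norm (f ^^ n))\<close>, which normality makes uniform in \<open>n\<close> on compact subsets of \<open>U\<close>.
\<close>

subsection \<open>Harnack's inequality and the Fatou set\<close>

text \<open>The Cayley transform \<open>F\<close> of \<open>q\<close> maps the disc into the unit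
  disc and sends the centre to 0, so the Schwarz lemma bounds \<open>norm (F w)\<close> by
  \<open>s\<close>. Written in terms of \<open>q\<close>, this is Harnack's inequality in both
  directions.\<close>

lemma harnack_re:
  assumes q: "q holomorphic_on ball c R" and pos: "\<And>z. z \<in> ball c R \<Longrightarrow> Re (q z) > 0"
    and s: "0 \<le> s" "s < 1" and z: "norm (z - c) \<le> s * R" and R: "R > 0"
  shows "(1 - s) * Re (q z) \<le> (1 + s) * Re (q c)"
    and "(1 - s) * Re (q c) \<le> (1 + s) * Re (q z)"
proof -
  define Q where "Q = (\<lambda>w. q (c + of_real R * w))"
  define F where "F = (\<lambda>w. (Q w - q c) / (Q w + cnj (q c)))"
  have inball: "c + of_real R * w \<in> ball c R" if "norm w < 1" for w
    using that R by (simp add: dist_norm norm_mult)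
  have Qh: "Q holomorphic_on ball 0 1"
    unfolding Q_def
    by (rule holomorphic_on_compose_gen[where g=q and t="ball c R", unfolded o_def])
       (auto intro!: holomorphic_intros q inball)
  have Qpos: "Re (Q w) > 0" if "norm w < 1" for w
    using pos[OF inball[OF that]] by (simp add: Q_def)
  have c0: "Re (q c) > 0" using pos[of c] R by simp
  have nz: "Q w + cnj (q c) \<noteq> 0" if "norm w < 1" for w
  proof
    assume "Q w + cnj (q c) = 0"
    then have "Re (Q w) + Re (q c) = 0" by (metis complex_cnj(1) plus_complex.sel(1) zero_complex.sel(1) cnj.sel(1))
    with Qpos[OF that] c0 show False by simp
  qed
  have Fh: "F holomorphic_on ball 0 1"
    unfolding F_def using nz by (intro holomorphic_intros Qh) auto
  have key: "norm (a - b)^2 = (Re a - Re b)^2 + (Im a - Im b)^2"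
     "norm (a + cnj b)^2 = (Re a + Re b)^2 + (Im a - Im b)^2" for a b :: complex
    by (auto simp: cmod_power2)
  have Flt: "norm (F w) < 1" if "norm w < 1" for w
  proof -
    have "Re (Q w) * Re (q c) > 0" using Qpos[OF that] c0 by simp
    then have "norm (Q w - q c)^2 < norm (Q w + cnj (q c))^2"
      unfolding key by (simp add: power2_eq_square algebra_simps)
    then have "norm (Q w - q c) < norm (Q w + cnj (q c))"
      by (rule power2_less_imp_less) simp
    then show ?thesis unfolding F_def using nz[OF that] by (simp add: norm_divide)
  qed
  define w where "w = (z - c) / of_real R"
  have w: "norm w \<le> s" using z R by (simp add: w_def norm_divide divide_le_eq)
  then have w1: "norm w < 1" using s by simp
  have Qw: "Q w = q z" using R by (simp add: Q_def w_def)
  have F0: "F 0 = 0" by (simp add: F_def Q_def)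
  have "norm (F w) \<le> norm w" by (rule Schwarz_Lemma(1)[OF Fh F0 Flt w1])
  then have "norm (F w) \<le> s" using w by simp
  then have le: "norm (q z - q c) \<le> s * norm (q z + cnj (q c))"
    using nz[OF w1] by (simp add: F_def norm_divide Qw divide_le_eq)
  define a b d where "a = Re (q z)" "b = Re (q c)" "d = Im (q z) - Im (q c)"
  have a: "a > 0" "b > 0" using Qpos[OF w1] Qw c0 by (auto simp: a_b_d_def)
  have "norm (q z - q c)^2 \<le> (s * norm (q z + cnj (q c)))^2"
    using le by (intro power_mono) auto
  then have "(a - b)^2 + d^2 \<le> s^2 * ((a + b)^2 + d^2)"
    by (simp add: power_mult_distrib key a_b_d_def)
  \<comment> \<open>Since \<open>s < 1\<close>, the term \<open>d^2\<close> on the left outweighs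
    its counterpart on the right, so that only real parts remain.\<close>
  moreover have "s^2 * d^2 \<le> d^2" using s by (intro mult_left_le_one_le) (auto simp: power_le_one)
  ultimately have "(a - b)^2 \<le> s^2 * (a + b)^2" by (simp only: distrib_left)
  then have "(a - b)^2 \<le> (s * (a + b))^2" by (simp only: power_mult_distrib)
  then have "\<bar>a - b\<bar> \<le> \<bar>s * (a + b)\<bar>" by (simp only: abs_le_square_iff)
  moreover have "s * (a + b) \<ge> 0" using a s by simp
  ultimately have "a - b \<le> s * (a + b)" "b - a \<le> s * (a + b)" by linarith+
  then show "(1 - s) * Re (q z) \<le> (1 + s) * Re (q c)" "(1 - s) * Re (q c) \<le> (1 + s) * Re (q z)"
    unfolding a_b_d_def by (simp_all only: distrib_left distrib_right left_diff_distrib mult_1)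
qed

text \<open>A zero-free \<open>h\<close> on a disc has a holomorphic logarithm \<open>g\<close>. The
  real part of \<open>A - g\<close> is \<open>A - ln (norm (h z))\<close>, positive because the
  bound \<open>exp A\<close> is strict, and Harnack's inequality applies to it.\<close>

lemma harnack_ln_norm:
  assumes h: "h holomorphic_on ball c R" and nz: "\<And>z. z \<in> ball c R \<Longrightarrow> h z \<noteq> 0"
    and lt: "\<And>z. z \<in> ball c R \<Longrightarrow> norm (h z) < exp A"
    and s: "0 \<le> s" "s < 1" and z: "norm (z - c) \<le> s * R" and R: "R > 0"
  shows "(1 - s) * (A - ln (norm (h z))) \<le> (1 + s) * (A - ln (norm (h c)))"
    and "(1 - s) * (A - ln (norm (h c))) \<le> (1 + s) * (A - ln (norm (h z)))"
proof -
  obtain g where g: "g holomorphic_on ball c R" "\<And>z. z \<in> ball c R \<Longrightarrow> h z = exp (g z)"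
    using holomorphic_logarithm_exists[of "ball c R" h c] h nz R by (metis convex_ball open_ball centre_in_ball)
  define q where "q = (\<lambda>z. of_real A - g z)"
  have ln: "Re (q z) = A - ln (norm (h z))" if "z \<in> ball c R" for z
    using g(2)[OF that] by (simp add: q_def)
  have zb: "z \<in> ball c R"
  proof -
    have "s * R < 1 * R" using s R by (intro mult_strict_right_mono) auto
    then show ?thesis using z by (simp add: dist_norm norm_minus_commute)
  qed
  have pos: "Re (q z) > 0" if "z \<in> ball c R" for z
  proof -
    have "ln (norm (h z)) < A" using lt[OF that] nz[OF that]
      by (metis exp_ln exp_less_cancel_iff zero_less_norm_iff)
    then show ?thesis using ln[OF that] by simp
  qed
  have "q holomorphic_on ball c R" unfolding q_def by (intro holomorphic_intros g)
  from harnack_re[OF this pos s z R] ln zb R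
  show "(1 - s) * (A - ln (norm (h z))) \<le> (1 + s) * (A - ln (norm (h c)))"
    "(1 - s) * (A - ln (norm (h c))) \<le> (1 + s) * (A - ln (norm (h z)))" by auto
qed

section \<open>Comparing the iterates at two points of the Fatou set\<close>

lemma funpow_holomorphic_UNIV:
  assumes "f holomorphic_on UNIV"
  shows "(f ^^ n) holomorphic_on UNIV"
proof (induction n)
  case 0
  then show ?case by (simp add: id_def holomorphic_on_ident)
next
  case (Suc n)
  then show ?case using holomorphic_on_compose_gen[OF Suc assms] by (simp add: o_def)
qed

lemma open_fatou_set: "open (fatou_set f)"
proof -
  have "fatou_set f = \<Union>{V. open V \<and> normal_family_on {f ^^ n |n. n \<ge> 1} V}"
    unfolding fatou_set_def by blast
  then show ?thesis by (simp add: open_Union)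
qed

text \<open>If no constant worked, some iterates would violate the inequality with every factor
  \<open>k\<close>. Normality yields a subsequence: under uniform convergence its values stay
  bounded, and under divergence to infinity the reciprocals are zero-free of modulus below 1, so
  Harnack's inequality compares them. Both contradict the growing factor.\<close>

lemma fatou_local_harnack:
  assumes f: "f holomorphic_on UNIV" and z0: "z0 \<in> fatou_set f"
  obtains N and C :: real where "open N" "z0 \<in> N"
    "\<And>n x y. n \<ge> 1 \<Longrightarrow> x \<in> N \<Longrightarrow> y \<in> N \<Longrightarrow>
       ln (norm ((f ^^ n) x) + 3) \<le> C * ln (norm ((f ^^ n) y) + 3)"
proof -
  obtain V where V: "open V" "z0 \<in> V" "normal_family_on {f ^^ n |n. n \<ge> 1} V"
    using z0 by (auto simp: fatou_set_def)
  obtain d' where d': "d' > 0" "cball z0 d' \<subseteq> V" using V open_contains_cball by blast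
  define d where "d = d' / 2"
  have d: "d > 0" "cball z0 (2 * d) \<subseteq> V" using d' by (auto simp: d_def)
  have "\<exists>C::real. \<forall>n\<ge>1. \<forall>x\<in>ball z0 d. \<forall>y\<in>ball z0 d.
       ln (norm ((f ^^ n) x) + 3) \<le> C * ln (norm ((f ^^ n) y) + 3)"
  proof (rule ccontr)
    assume neg: "\<not> ?thesis"
    have "\<exists>n x y. n \<ge> 1 \<and> x \<in> ball z0 d \<and> y \<in> ball z0 d \<and>
       ln (norm ((f ^^ n) x) + 3) > real k * ln (norm ((f ^^ n) y) + 3)" for k :: nat
      using neg[unfolded not_ex, rule_format, of "real k"] unfolding not_le[symmetric] by blast
    then obtain nn x y where nn: "\<And>k. nn k \<ge> 1" and xy: "\<And>k::nat. x k \<in> ball z0 d" "\<And>k. y k \<in> ball z0 d"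
      and big: "\<And>k. ln (norm ((f ^^ nn k) (x k)) + 3) > real k * ln (norm ((f ^^ nn k) (y k)) + 3)"
      by metis
    define h where "h k = f ^^ nn k" for k
    have hh: "h k holomorphic_on S" for k S
      unfolding h_def using funpow_holomorphic_UNIV[OF f] holomorphic_on_subset by blast
    have "range h \<subseteq> {f ^^ n |n. n \<ge> 1}" using nn by (auto simp: h_def)
    then obtain \<kappa> :: "nat \<Rightarrow> nat" where sm: "strict_mono \<kappa>" and alt:
      "(\<exists>g. \<forall>K. compact K \<and> K \<subseteq> V \<longrightarrow> uniform_limit K (\<lambda>n. h (\<kappa> n)) g sequentially) \<or>
          (\<forall>K. compact K \<and> K \<subseteq> V \<longrightarrow>
             (\<forall>R::real. \<forall>\<^sub>F n in sequentially. \<forall>z\<in>K. norm (h (\<kappa> n) z) > R))"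
      using V(3) unfolding normal_family_on_def by blast
    have kge: "\<kappa> n \<ge> n" for n using sm by (rule seq_suble)
    let ?K = "cball z0 (2 * d)"
    have K: "compact ?K" "?K \<subseteq> V" using d by auto
    have xyK: "x k \<in> ?K" "y k \<in> ?K" for k
      using xy[of k] d by auto
    from alt show False
    proof
      assume "\<exists>g. \<forall>K. compact K \<and> K \<subseteq> V \<longrightarrow> uniform_limit K (\<lambda>n. h (\<kappa> n)) g sequentially"
      then obtain g where "uniform_limit ?K (\<lambda>n. h (\<kappa> n)) g sequentially" using K by blast
      then have "\<forall>\<^sub>F n in sequentially. \<forall>z\<in>?K. dist (h (\<kappa> n) z) (g z) < 1"
        unfolding uniform_limit_iff by (auto dest: spec[of _ 1])
      then obtain n0 where n0: "\<And>n z. n \<ge> n0 \<Longrightarrow> z \<in> ?K \<Longrightarrow> dist (h (\<kappa> n) z) (g z) < 1"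
        unfolding eventually_sequentially by meson
      \<comment> \<open>Nothing is known about \<open>g\<close> itself; the single iterate
        \<open>h (\<kappa> n0)\<close>, bounded on the compact disc, lies within 2 of all later ones
        and gives a bound uniform in \<open>n\<close>.\<close>
      have "compact (h (\<kappa> n0) ` ?K)"
        by (intro compact_continuous_image holomorphic_on_imp_continuous_on hh K)
      then have "bounded (h (\<kappa> n0) ` ?K)" by (rule compact_imp_bounded)
      then obtain B where B: "\<And>z. z \<in> ?K \<Longrightarrow> norm (h (\<kappa> n0) z) \<le> B"
        unfolding bounded_iff by blast
      define n where "n = max n0 (nat \<lceil>\<bar>ln (B + 5)\<bar>\<rceil>)"
      have "dist (h (\<kappa> n) (x (\<kappa> n))) (g (x (\<kappa> n))) < 1" "dist (h (\<kappa> n0) (x (\<kappa> n))) (g (x (\<kappa> n))) < 1"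
        using n0 xyK by (auto simp: n_def)
      then have "dist (h (\<kappa> n) (x (\<kappa> n))) (h (\<kappa> n0) (x (\<kappa> n))) < 2"
        using dist_triangle2[of "h (\<kappa> n) (x (\<kappa> n))" "h (\<kappa> n0) (x (\<kappa> n))" "g (x (\<kappa> n))"] by linarith
      then have "norm (h (\<kappa> n) (x (\<kappa> n))) \<le> B + 2"
        using B[OF xyK(1), of "\<kappa> n"] norm_triangle_sub[of "h (\<kappa> n) (x (\<kappa> n))" "h (\<kappa> n0) (x (\<kappa> n))"]
        by (simp add: dist_norm)
      then have 1: "ln (norm (h (\<kappa> n) (x (\<kappa> n))) + 3) \<le> ln (B + 5)"
        by (intro ln_mono) (auto intro: add_nonneg_pos)
      have "ln (exp 1) \<le> ln (norm (h (\<kappa> n) (y (\<kappa> n))) + 3)"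
        using exp_le by (intro ln_mono) (auto intro: add_increasing)
      then have "real (\<kappa> n) * 1 \<le> real (\<kappa> n) * ln (norm (h (\<kappa> n) (y (\<kappa> n))) + 3)"
        by (intro mult_left_mono) auto
      with big[of "\<kappa> n"] 1 have "real (\<kappa> n) < ln (B + 5)" by (simp add: h_def)
      moreover have "real (\<kappa> n) \<ge> real n" using kge by simp
      moreover have "real n \<ge> \<bar>ln (B + 5)\<bar>" unfolding n_def by linarith
      ultimately show False by linarith
    next
      assume "\<forall>K. compact K \<and> K \<subseteq> V \<longrightarrow>
             (\<forall>R::real. \<forall>\<^sub>F n in sequentially. \<forall>z\<in>K. norm (h (\<kappa> n) z) > R)"
      then have "\<forall>\<^sub>F n in sequentially. \<forall>z\<in>?K. norm (h (\<kappa> n) z) > 5" using K by blast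
      then obtain n0 where n0: "\<And>n z. n \<ge> n0 \<Longrightarrow> z \<in> ?K \<Longrightarrow> norm (h (\<kappa> n) z) > 5"
        unfolding eventually_sequentially by meson
      \<comment> \<open>The threshold 18 is 2 * 3 * 3: two Harnack comparisons through
        \<open>z0\<close> at half the radius, each with factor (1 + 1/2) / (1 - 1/2) = 3, and a
        factor 2 from \<open>a + 3 \<le> a * a\<close>.\<close>
      define j where "j = \<kappa> (max n0 18)"
      have j: "j \<ge> 18" using kge[of "max n0 18"] by (simp add: j_def)
      have gt: "norm (h j z) > 5" if "z \<in> ?K" for z unfolding j_def by (rule n0) (use that in auto)
      define q where "q = (\<lambda>z. inverse (h j z))"
      have gtb: "norm (h j z) > 5" if "z \<in> ball z0 (2 * d)" for z using gt that by auto
      have nz: "q z \<noteq> 0" if "z \<in> ball z0 (2 * d)" for z using gtb[OF that] by (auto simp: q_def)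
      have q: "q holomorphic_on ball z0 (2 * d)"
        unfolding q_def using nz by (intro holomorphic_intros hh) (auto simp: q_def)
      have lt: "norm (q z) < exp 0" if "z \<in> ball z0 (2 * d)" for z
        using gtb[OF that] by (simp add: q_def norm_inverse inverse_less_1_iff)
      have xn: "norm (x j - z0) \<le> 1 / 2 * (2 * d)" "norm (y j - z0) \<le> 1 / 2 * (2 * d)"
        using xy[of j] by (auto simp: dist_norm norm_minus_commute)
      have lnq: "ln (norm (q z)) = - ln (norm (h j z))" for z by (simp add: q_def norm_inverse ln_inverse)
      have A: "ln (norm (h j (x j))) \<le> 3 * ln (norm (h j z0))"
        using harnack_ln_norm(1)[OF q nz lt, of "1/2" "x j"] xn d by (simp add: lnq)
      have B: "ln (norm (h j z0)) \<le> 3 * ln (norm (h j (y j)))"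
        using harnack_ln_norm(2)[OF q nz lt, of "1/2" "y j"] xn d by (simp add: lnq)
      define a where "a = norm (h j (x j))"
      define b where "b = norm (h j (y j))"
      have ab: "a > 5" "b > 5" using gt xyK by (auto simp: a_def b_def)
      have "5 * a \<le> a * a" using ab by (intro mult_right_mono) auto
      then have "a + 3 \<le> a * a" using ab by linarith
      then have "ln (a + 3) \<le> ln (a * a)" using ab by (subst ln_le_cancel_iff) auto
      also have "\<dots> = 2 * ln a" using ab by (simp add: ln_mult)
      also have "\<dots> \<le> 18 * ln b" using A B by (simp add: a_def b_def)
      also have "\<dots> \<le> 18 * ln (b + 3)" using ab by simp
      also have "\<dots> \<le> real j * ln (b + 3)" using j ab by (intro mult_right_mono) auto
      finally show False using big[of j] by (simp add: a_def b_def h_def)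
    qed
  qed
  then obtain C :: real where C: "\<forall>n\<ge>1. \<forall>x\<in>ball z0 d. \<forall>y\<in>ball z0 d.
       ln (norm ((f ^^ n) x) + 3) \<le> C * ln (norm ((f ^^ n) y) + 3)" by blast
  show ?thesis using that[of "ball z0 d" C] C d by (metis centre_in_ball open_ball)
qed

text \<open>Comparability with a constant independent of \<open>n\<close> is an equivalence relation
  whose classes are open by the local estimate, so connectedness makes \<open>U\<close> a single
  class. Finitely many local neighbourhoods covering \<open>K\<close> then give one
  constant.\<close>

lemma fatou_component_harnack:
  assumes f: "f holomorphic_on UNIV" and U: "U \<in> components (fatou_set f)"
    and w: "w \<in> U" and K: "compact K" "K \<subseteq> U"
  obtains C :: real where "\<And>n y. n \<ge> 1 \<Longrightarrow> y \<in> K \<Longrightarrow>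
       ln (norm ((f ^^ n) y) + 3) \<le> C * ln (norm ((f ^^ n) w) + 3)"
proof -
  define l where "l n z = ln (norm ((f ^^ n) z) + 3)" for n z
  have lpos: "l n z \<ge> 0" for n z by (simp add: l_def)
  have sub: "U \<subseteq> fatou_set f" using U in_components_subset by blast
  have opU: "open U" using U open_fatou_set open_components by blast
  have loc: "\<exists>N C::real. open N \<and> a \<in> N \<and> C \<ge> 0 \<and> (\<forall>n\<ge>1. \<forall>x\<in>N. \<forall>y\<in>N. l n x \<le> C * l n y)"
    if aU: "a \<in> U" for a
  proof -
    obtain N C where N: "open N" "a \<in> N"
      "\<And>n x y. n \<ge> 1 \<Longrightarrow> x \<in> N \<Longrightarrow> y \<in> N \<Longrightarrow>
         ln (norm ((f ^^ n) x) + 3) \<le> C * ln (norm ((f ^^ n) y) + 3)"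
      by (rule fatou_local_harnack[OF f subsetD[OF sub aU]]) blast
    have "l n x \<le> \<bar>C\<bar> * l n y" if "n \<ge> 1" "x \<in> N" "y \<in> N" for n x y
    proof -
      have "l n x \<le> C * l n y" using N(3)[OF that] by (simp add: l_def)
      also have "\<dots> \<le> \<bar>C\<bar> * l n y" using lpos by (intro mult_right_mono) auto
      finally show ?thesis .
    qed
    then show ?thesis using N by (intro exI[of _ N] exI[of _ "\<bar>C\<bar>"]) auto
  qed
  define E where "E x y \<longleftrightarrow> (\<exists>C::real. C \<ge> 0 \<and> (\<forall>n\<ge>1. l n x \<le> C * l n y \<and> l n y \<le> C * l n x))" for x y
  have rel: "E w y" if y: "y \<in> U" for y
  proof (rule connected_equivalence_relation[of U w y E])
    show "connected U" using U in_components_connected by blast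
    show "w \<in> U" "y \<in> U" by fact+
    show "E y x" if "E x y" for x y using that by (auto simp: E_def)
    show "E x z" if xy: "E x y" and yz: "E y z" for x y z
    proof -
      obtain C D where C: "C \<ge> 0" "\<And>n. n \<ge> 1 \<Longrightarrow> l n x \<le> C * l n y" "\<And>n. n \<ge> 1 \<Longrightarrow> l n y \<le> C * l n x"
        and D: "D \<ge> 0" "\<And>n. n \<ge> 1 \<Longrightarrow> l n y \<le> D * l n z" "\<And>n. n \<ge> 1 \<Longrightarrow> l n z \<le> D * l n y"
        using xy yz unfolding E_def by metis
      have "l n x \<le> C * D * l n z \<and> l n z \<le> C * D * l n x" if "n \<ge> 1" for n
        using C(2,3)[OF that] D(2,3)[OF that] mult_left_mono[OF D(2)[OF that] C(1)]
          mult_left_mono[OF C(3)[OF that] D(1)] by (simp add: mult.assoc mult.left_commute)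
      then show ?thesis unfolding E_def using C(1) D(1) by (intro exI[of _ "C * D"]) auto
    qed
    show "\<exists>T. openin (top_of_set U) T \<and> a \<in> T \<and> (\<forall>x\<in>T. E a x)" if aU: "a \<in> U" for a
    proof -
      obtain N C where N: "open N" "a \<in> N" "C \<ge> 0" "\<forall>n\<ge>1. \<forall>x\<in>N. \<forall>y\<in>N. l n x \<le> C * l n y"
        using loc[OF aU] by blast
      then have "\<forall>x\<in>U \<inter> N. E a x" unfolding E_def by blast
      then show ?thesis using N aU by (intro exI[of _ "U \<inter> N"]) auto
    qed
  qed
  have ex: "\<exists>N C. open N \<and> a \<in> N \<and> (\<forall>n\<ge>1. \<forall>y\<in>N. l n y \<le> C * l n w)" if a: "a \<in> K" for a
  proof -
    have aU: "a \<in> U" using a K by auto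
    obtain N C where N: "open N" "a \<in> N" "C \<ge> 0" "\<forall>n\<ge>1. \<forall>x\<in>N. \<forall>y\<in>N. l n x \<le> C * l n y"
      using loc[OF aU] by blast
    obtain D where D: "D \<ge> 0" "\<forall>n\<ge>1. l n a \<le> D * l n w" using rel[OF aU] unfolding E_def by blast
    have "l n y \<le> (C * D) * l n w" if "n \<ge> 1" "y \<in> N" for n y
    proof -
      have "l n y \<le> C * l n a" using N that by blast
      also have "\<dots> \<le> C * (D * l n w)" using D that N by (intro mult_left_mono) auto
      finally show ?thesis by (simp add: mult.assoc)
    qed
    then show ?thesis using N by blast
  qed
  then obtain N C where NC: "\<And>a. a \<in> K \<Longrightarrow> open (N a) \<and> a \<in> N a \<and> (\<forall>n\<ge>1. \<forall>y\<in>N a. l n y \<le> C a * l n w)"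
    by metis
  obtain A where A: "A \<subseteq> K" "finite A" "K \<subseteq> (\<Union>a\<in>A. N a)"
    using compactE_image[OF K(1), of K N] NC by blast
  define D where "D = (\<Sum>a\<in>A. \<bar>C a\<bar>)"
  show ?thesis
  proof (rule that[of D])
    fix n :: nat and y assume n: "n \<ge> 1" and y: "y \<in> K"
    obtain a where a: "a \<in> A" "y \<in> N a" using A y by blast
    have "l n y \<le> C a * l n w" using NC a A n by blast
    also have "\<dots> \<le> D * l n w"
    proof (rule mult_right_mono)
      have "C a \<le> \<bar>C a\<bar>" by simp
      also have "\<dots> \<le> D" unfolding D_def using a A by (intro member_le_sum) auto
      finally show "C a \<le> D" .
    qed (rule lpos)
    finally show "ln (norm ((f ^^ n) y) + 3) \<le> D * ln (norm ((f ^^ n) w) + 3)" by (simp add: l_def)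
  qed
qed

subsection \<open>Maximum modulus and zeros of entire functions\<close>

lemma norm_le_of_sphere:
  assumes g: "g holomorphic_on UNIV" and le: "\<And>z. norm z = r \<Longrightarrow> norm (g z) \<le> B" and z: "norm z \<le> r"
  shows "norm (g z) \<le> (B::real)"
proof (rule maximum_modulus_frontier[of g "cball 0 r"])
  show "g holomorphic_on interior (cball 0 r)" using g holomorphic_on_subset by blast
  show "continuous_on (closure (cball 0 r)) g"
    using g holomorphic_on_imp_continuous_on continuous_on_subset by blast
  show "norm (g w) \<le> B" if "w \<in> frontier (cball 0 r)" for w
    using that by (intro le) (simp add: frontier_cball)
qed (use z in auto)

lemma max_modulus_attained:
  assumes "f holomorphic_on UNIV" and "r \<ge> 0"
  obtains z where "norm z = r" "norm (f z) = max_modulus r f"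
    "\<And>w. norm w = r \<Longrightarrow> norm (f w) \<le> max_modulus r f"
proof -
  have "continuous_on (sphere 0 r) (\<lambda>z. norm (f z))"
    using assms(1) by (intro continuous_intros) (meson continuous_on_subset holomorphic_on_imp_continuous_on top_greatest)
  moreover have "sphere (0::complex) r \<noteq> {}" using assms by simp
  ultimately obtain z where z: "z \<in> sphere 0 r" "\<And>w. w \<in> sphere 0 r \<Longrightarrow> norm (f w) \<le> norm (f z)"
    using continuous_attains_sup[of "sphere 0 r" "\<lambda>z. norm (f z)"] by (metis compact_sphere)
  have "max_modulus r f = norm (f z)"
    unfolding max_modulus_def using z by (intro cSup_eq_maximum) auto
  then show ?thesis using that[of z] z by auto
qed

lemma norm_le_max_modulus:
  assumes f: "f holomorphic_on UNIV" and z: "norm z \<le> r"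
  shows "norm (f z) \<le> max_modulus r f"
proof -
  have "r \<ge> 0" using z norm_ge_zero order_trans by blast
  then show ?thesis using norm_le_of_sphere[OF f _ z] max_modulus_attained[OF f] by metis
qed

lemma max_modulus_le:
  assumes f: "f holomorphic_on UNIV" and r: "r \<ge> 0" and le: "\<And>z. norm z = r \<Longrightarrow> norm (f z) \<le> B"
  shows "max_modulus r f \<le> B"
  using max_modulus_attained[OF f r] le by metis

lemma max_modulus_mono:
  assumes f: "f holomorphic_on UNIV" and "0 \<le> r" "r \<le> s"
  shows "max_modulus r f \<le> max_modulus s f"
  using assms by (intro max_modulus_le norm_le_max_modulus) auto

lemma max_modulus_pos:
  assumes f: "f holomorphic_on UNIV" and nz: "f z0 \<noteq> 0" and r: "r > 0"
  shows "max_modulus r f > 0"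
proof (rule ccontr)
  assume neg: "\<not> ?thesis"
  have "f z = 0" if "z \<in> ball 0 r" for z
  proof -
    have "norm (f z) \<le> max_modulus r f" by (rule norm_le_max_modulus[OF f]) (use that in auto)
    then have "norm (f z) \<le> 0" using neg by linarith
    then show ?thesis by simp
  qed
  then have "f z0 = 0"
    by (intro analytic_continuation_open[of "ball 0 r" UNIV f "\<lambda>_. 0" z0])
       (use f r connected_UNIV in auto)
  with nz show False by simp
qed

text \<open>Hadamard's theorem: the maximum principle on an annulus is applied to
  \<open>f z ^ q / z ^ p\<close>, with \<open>p / q\<close> approximating the slope of the chord
  from above. Integer powers avoid a multivalued power of \<open>z\<close>, and the rounding error
  disappears as \<open>q\<close> grows.\<close>

lemma three_circles:
  assumes f: "f holomorphic_on UNIV" and nz: "f z0 \<noteq> 0" and t: "0 \<le> t" "t \<le> T" "0 < T"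
  shows "T * (ln (max_modulus (exp t) f) - ln (max_modulus 1 f)) \<le>
         t * (ln (max_modulus (exp T) f) - ln (max_modulus 1 f))"
proof -
  define L where "L x = ln (max_modulus (exp x) f)" for x
  have pos: "max_modulus (exp x) f > 0" for x by (rule max_modulus_pos[OF f nz]) simp
  have M: "max_modulus (exp x) f = exp (L x)" for x using pos by (simp add: L_def)
  have L0: "L 0 = ln (max_modulus 1 f)" by (simp add: L_def)
  have LT: "L 0 \<le> L T" unfolding L_def
    using max_modulus_mono[OF f, of "exp 0" "exp T"] pos[of 0] t by (intro ln_mono) auto
  have main: "L t - L 0 \<le> ((L T - L 0) / T + 1 / real q) * t" if q: "q > 0" for q :: nat
  proof -
    \<comment> \<open>Rounding up makes the bound on the outer circle no larger than the one on the
      inner circle (\<open>p1\<close>), at a cost of at most 1 in \<open>p\<close>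
      (\<open>p2\<close>).\<close>
    define p where "p = nat \<lceil>real q * (L T - L 0) / T\<rceil>"
    have nn: "real q * (L T - L 0) / T \<ge> 0" using LT t by simp
    have p1: "real q * (L T - L 0) / T \<le> real p" unfolding p_def by linarith
    have p2: "real p \<le> real q * (L T - L 0) / T + 1" unfolding p_def using nn by linarith
    define S where "S = {z::complex. 1 \<le> norm z \<and> norm z \<le> exp T}"
    define h where "h = (\<lambda>z. f z ^ q / z ^ p)"
    obtain z where z: "norm z = exp t" "norm (f z) = max_modulus (exp t) f"
      using max_modulus_attained[OF f, of "exp t"] by auto
    have cl: "closed S"
    proof -
      have "S = cball 0 (exp T) - ball 0 1" by (auto simp: S_def)
      then show ?thesis by (simp add: closed_Diff)
    qed
    have hS: "h holomorphic_on S" unfolding h_def S_def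
      by (intro holomorphic_intros holomorphic_on_subset[OF f]) auto
    have "norm (h z) \<le> exp (real q * L 0)"
    proof (rule maximum_modulus_frontier[of h S])
      show "h holomorphic_on interior S" using hS holomorphic_on_subset interior_subset by blast
      show "continuous_on (closure S) h" using hS cl holomorphic_on_imp_continuous_on by simp
      show "bounded S" unfolding S_def by (auto simp: bounded_iff)
      show "z \<in> S" using z t by (simp add: S_def)
      show "norm (h w) \<le> exp (real q * L 0)" if w: "w \<in> frontier S" for w
      proof -
        have "{z::complex. 1 < norm z \<and> norm z < exp T} \<subseteq> interior S"
        proof (rule interior_maximal)
          have "{z::complex. 1 < norm z \<and> norm z < exp T} = ball 0 (exp T) - cball 0 1" by auto
          then show "open {z::complex. 1 < norm z \<and> norm z < exp T}" by (simp add: open_Diff)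
        qed (auto simp: S_def)
        moreover have "w \<in> S" "w \<notin> interior S" using w cl by (auto simp: frontier_def)
        ultimately have "norm w = 1 \<or> norm w = exp T" unfolding S_def by force
        then show ?thesis
        proof
          assume 1: "norm w = 1"
          then have "norm (f w) \<le> exp (L 0)" using norm_le_max_modulus[OF f, of w 1] M[of 0] by simp
          then have "norm (f w) ^ q \<le> exp (L 0) ^ q" by (intro power_mono) auto
          then show ?thesis using 1 by (simp add: h_def norm_divide norm_power exp_of_nat_mult)
        next
          assume 1: "norm w = exp T"
          then have "norm (f w) \<le> exp (L T)" using norm_le_max_modulus[OF f, of w "exp T"] M[of T] by simp
          then have "norm (f w) ^ q \<le> exp (L T) ^ q" by (intro power_mono) auto
          then have "norm (h w) \<le> exp (L T) ^ q / exp T ^ p"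
            using 1 by (simp add: h_def norm_divide norm_power divide_right_mono)
          also have "\<dots> = exp (real q * L T - real p * T)" by (simp add: exp_of_nat_mult exp_diff)
          also have "\<dots> \<le> exp (real q * L 0)"
            using p1 t by (simp add: field_simps)
          finally show ?thesis .
        qed
      qed
    qed
    moreover have "norm (h z) = exp (real q * L t - real p * t)"
      using z by (simp add: h_def norm_divide norm_power M exp_of_nat_mult exp_diff)
    ultimately have "real q * (L t - L 0) \<le> real p * t" by (simp add: algebra_simps)
    also have "\<dots> \<le> (real q * (L T - L 0) / T + 1) * t" using p2 t by (intro mult_right_mono) auto
    also have "\<dots> \<le> real q * (((L T - L 0) / T + 1 / real q) * t)"
    proof -
      have "real q * ((L T - L 0) / T + 1 / real q) = real q * (L T - L 0) / T + 1"
        using q by (simp add: distrib_left)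
      then show ?thesis by (metis mult.assoc order.refl)
    qed
    finally have "real q * (L t - L 0) \<le> real q * (((L T - L 0) / T + 1 / real q) * t)" .
    then show ?thesis using q by (simp add: mult_le_cancel_left_pos)
  qed
  have "(\<lambda>q. ((L T - L 0) / T + 1 / real q) * t) \<longlonglongrightarrow> ((L T - L 0) / T + 0) * t"
    by (intro tendsto_intros lim_1_over_n)
  then have "L t - L 0 \<le> ((L T - L 0) / T + 0) * t"
    by (rule tendsto_lowerbound) (auto intro!: main eventually_sequentiallyI[of 1])
  then show ?thesis using t unfolding L0[symmetric] L_def[symmetric] by (simp add: field_simps)
qed

section \<open>Factoring out the zeros in a disc\<close>

lemma entire_divide_zero:
  assumes f: "f holomorphic_on UNIV" and nz: "f z1 \<noteq> 0"
  obtains n g where "g holomorphic_on UNIV" "g a \<noteq> 0" "\<And>z. f z = (z - a) ^ n * g z"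
    "f a = 0 \<longleftrightarrow> n > 0"
proof -
  define n where "n = nat (zorder f a)"
  have "connected (UNIV :: complex set)" "\<exists>w\<in>UNIV. f w \<noteq> 0" using nz by auto
  from zorder_exist_zero[OF f open_UNIV this(1) UNIV_I this(2), of a] obtain r
    where r: "r > 0" "zor_poly f a holomorphic_on cball a r"
      and eq: "\<forall>w\<in>cball a r. f w = zor_poly f a w * (w - a) ^ n \<and> zor_poly f a w \<noteq> 0"
      and ord: "if f a = 0 then zorder f a > 0 else zorder f a = 0"
    unfolding n_def by metis
  define g where "g z = (if z = a then zor_poly f a a else f z / (z - a) ^ n)" for z
  have "g holomorphic_on (UNIV - {a}) \<union> ball a r"
  proof (rule holomorphic_on_Un)
    have "(\<lambda>z. f z / (z - a) ^ n) holomorphic_on UNIV - {a}"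
      by (intro holomorphic_intros holomorphic_on_subset[OF f]) auto
    then show "g holomorphic_on UNIV - {a}"
      by (rule holomorphic_transform) (auto simp: g_def)
    have "zor_poly f a holomorphic_on ball a r" using r(2) holomorphic_on_subset by (metis ball_subset_cball)
    then show "g holomorphic_on ball a r"
      by (rule holomorphic_transform) (use eq in \<open>auto simp: g_def\<close>)
  qed auto
  moreover have "(UNIV - {a}) \<union> ball a r = UNIV" using r by auto
  ultimately have "g holomorphic_on UNIV" by simp
  moreover have "g a \<noteq> 0" using eq r by (auto simp: g_def)
  moreover have "f z = (z - a) ^ n * g z" for z
    using eq r by (cases "z = a") (auto simp: g_def)
  moreover have "f a = 0 \<longleftrightarrow> n > 0" using ord unfolding n_def by (auto split: if_splits)
  ultimately show ?thesis by (rule that)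
qed

text \<open>Induction on the number of distinct zeros in the disc, each removed with its full
  multiplicity. Because \<open>f 0 \<noteq> 0\<close>, the factors can be normalised to 1 at the
  origin.\<close>

lemma entire_divide_zeros:
  assumes "f holomorphic_on UNIV" and "f 0 \<noteq> 0"
  shows "\<exists>as g. g holomorphic_on UNIV \<and> (\<forall>a\<in>set as. a \<noteq> 0 \<and> norm a \<le> R) \<and>
     (\<forall>z. f z = (\<Prod>a\<leftarrow>as. 1 - z / a) * g z) \<and> (\<forall>z\<in>cball 0 R. g z \<noteq> 0)"
  using assms
proof (induction "card {z \<in> cball 0 R. f z = 0}" arbitrary: f rule: less_induct)
  case less
  show ?case
  proof (cases "{z \<in> cball 0 R. f z = 0} = {}")
    case True
    then show ?thesis using less.prems by (intro exI[of _ "[]"] exI[of _ f]) auto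
  next
    case False
    then obtain a where a: "norm a \<le> R" "f a = 0" by auto
    then have a0: "a \<noteq> 0" using less.prems by auto
    obtain n h where h: "h holomorphic_on UNIV" "h a \<noteq> 0" "\<And>z. f z = (z - a) ^ n * h z"
        "f a = 0 \<longleftrightarrow> n > 0"
      using entire_divide_zero[OF less.prems] by metis
    \<comment> \<open>The constant \<open>(- a) ^ n\<close> converts \<open>(z - a) ^ n\<close> into
      the normalised factor \<open>(1 - z / a) ^ n\<close>.\<close>
    define k where "k z = (- a) ^ n * h z" for z
    have kz: "k z = 0 \<longleftrightarrow> h z = 0" for z using a0 by (simp add: k_def)
    have kh: "k holomorphic_on UNIV" unfolding k_def by (intro holomorphic_intros h)
    have k0: "k 0 \<noteq> 0" using less.prems h(3)[of 0] unfolding kz by auto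
    have "finite {z \<in> cball 0 R. f z = 0}"
    proof (rule holomorphic_compact_finite_zeros[of f UNIV])
      show "\<not> f constant_on UNIV" using a less.prems unfolding constant_on_def by (metis UNIV_I)
    qed (use less.prems in auto)
    moreover have "{z \<in> cball 0 R. k z = 0} \<subset> {z \<in> cball 0 R. f z = 0}"
      using a h kz by auto
    ultimately have "card {z \<in> cball 0 R. k z = 0} < card {z \<in> cball 0 R. f z = 0}"
      by (rule psubset_card_mono)
    from less.hyps[OF this kh k0] obtain as g where g: "g holomorphic_on UNIV"
      "\<forall>a\<in>set as. a \<noteq> 0 \<and> norm a \<le> R" "\<forall>z. k z = (\<Prod>a\<leftarrow>as. 1 - z / a) * g z"
      "\<forall>z\<in>cball 0 R. g z \<noteq> 0" by blast
    have "f z = (\<Prod>b\<leftarrow>replicate n a @ as. 1 - z / b) * g z" for z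
    proof -
      have "f z = ((z - a) / (- a)) ^ n * k z"
      proof -
        have "(z - a) / (- a) * (- a) = z - a" using a0 by simp
        then have "((z - a) / (- a)) ^ n * (- a) ^ n = (z - a) ^ n" by (metis power_mult_distrib)
        then show ?thesis unfolding h(3)[of z] k_def by (metis mult.assoc)
      qed
      also have "(z - a) / (- a) = 1 - z / a" using a0 by (simp add: field_simps)
      finally show ?thesis using g(3) by (simp add: prod_list_replicate mult.assoc)
    qed
    moreover have "\<forall>b\<in>set (replicate n a @ as). b \<noteq> 0 \<and> norm b \<le> R" using g(2) a0 a by auto
    ultimately show ?thesis using g by blast
  qed
qed

lemma prod_list_mono_nonneg:
  assumes "\<And>x. x \<in> set xs \<Longrightarrow> 0 \<le> f x \<and> f x \<le> (g x :: real)"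
  shows "0 \<le> (\<Prod>x\<leftarrow>xs. f x)" "(\<Prod>x\<leftarrow>xs. f x) \<le> (\<Prod>x\<leftarrow>xs. g x)"
proof -
  have "0 \<le> (\<Prod>x\<leftarrow>xs. f x) \<and> (\<Prod>x\<leftarrow>xs. f x) \<le> (\<Prod>x\<leftarrow>xs. g x)"
    using assms by (induction xs) (auto intro!: mult_mono intro: order_trans)
  then show "0 \<le> (\<Prod>x\<leftarrow>xs. f x)" "(\<Prod>x\<leftarrow>xs. f x) \<le> (\<Prod>x\<leftarrow>xs. g x)" by auto
qed

lemma norm_prod_list_map: "norm (\<Prod>x\<leftarrow>xs. f x :: complex) = (\<Prod>x\<leftarrow>xs. norm (f x))"
  by (induction xs) (auto simp: norm_mult)

text \<open>The numbers \<open>bs\<close> are the moduli of the nonzero zeros of \<open>f\<close> in the disc of radius \<open>R\<close>; the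
  factor \<open>exp (E * norm z)\<close> accounts for all the other zeros.\<close>
definition zero_split :: "(complex \<Rightarrow> complex) \<Rightarrow> nat \<Rightarrow> real \<Rightarrow> real \<Rightarrow> real \<Rightarrow> real list \<Rightarrow> bool" where
  "zero_split f p c R E bs \<longleftrightarrow> (\<forall>b\<in>set bs. 0 < b \<and> b \<le> R) \<and>
     (\<forall>\<rho>\<ge>3*R. c * \<rho>^p * (\<Prod>b\<leftarrow>bs. \<rho> / b - 1) \<le> max_modulus \<rho> f) \<and>
     (\<forall>z. norm z \<le> R / 2 \<longrightarrow>
        c * norm z ^ p * (\<Prod>b\<leftarrow>bs. \<bar>1 - norm z / b\<bar>) * exp (- E * norm z) \<le> norm (f z) \<and>
        norm (f z) \<le> c * norm z ^ p * (\<Prod>b\<leftarrow>bs. 1 + norm z / b) * exp (E * norm z))"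

text \<open>The factor \<open>z ^ p\<close> is split off and \<open>c\<close> is the modulus of the
  remaining function at 0, so neither depends on \<open>R\<close>. Dividing by the zeros in the disc
  leaves a \<open>g\<close> without zeros there, bounded by the maximum modulus at
  \<open>3 * R\<close>; Harnack's inequality keeps \<open>ln (norm (g z))\<close> within
  \<open>E * norm z\<close> of \<open>ln c\<close>.\<close>

lemma zero_decomposition:
  assumes f: "f holomorphic_on UNIV" and nz: "f z1 \<noteq> 0"
  obtains p :: nat and c :: real where "c > 0"
    "\<And>R E. R \<ge> 1 \<Longrightarrow> E = 4 * (ln (max_modulus (3 * R) f) + 1 - ln c) / R \<Longrightarrow>
      E \<ge> 0 \<and> (\<exists>bs. zero_split f p c R E bs)"
proof -
  obtain p f1 where f1: "f1 holomorphic_on UNIV" "f1 0 \<noteq> 0" "\<And>z. f z = z ^ p * f1 z"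
    using entire_divide_zero[OF f nz, of 0] by (metis diff_zero)
  define c where "c = norm (f1 0)"
  have c: "c > 0" using f1 by (simp add: c_def)
  show ?thesis
  proof (rule that[OF c, where p=p], goal_cases)
    case (1 R E)
    then have R: "R \<ge> 1" and E: "E = 4 * (ln (max_modulus (3 * R) f) + 1 - ln c) / R" by auto
    obtain as g where g: "g holomorphic_on UNIV" "\<forall>a\<in>set as. a \<noteq> 0 \<and> norm a \<le> R"
      "\<And>z. f1 z = (\<Prod>a\<leftarrow>as. 1 - z / a) * g z" "\<forall>z\<in>cball 0 R. g z \<noteq> 0"
      using entire_divide_zeros[OF f1(1,2), of R] by metis
    have "f1 0 = g 0"
      using g(3)[of 0] by (simp add: map_replicate_const prod_list_replicate)
    then have g0: "norm (g 0) = c" by (simp add: c_def)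
    define bs where "bs = map norm as"
    have bs: "\<forall>b\<in>set bs. 0 < b \<and> b \<le> R" using g(2) by (auto simp: bs_def)
    have P: "norm (\<Prod>a\<leftarrow>as. 1 - z / a) = (\<Prod>a\<leftarrow>as. norm (1 - z / a))" for z
      by (rule norm_prod_list_map)
    have lo: "(\<Prod>b\<leftarrow>bs. \<bar>1 - norm z / b\<bar>) \<le> norm (\<Prod>a\<leftarrow>as. 1 - z / a)" for z
      unfolding P bs_def map_map o_def
    proof (rule prod_list_mono_nonneg(2))
      show "0 \<le> \<bar>1 - norm z / norm a\<bar> \<and> \<bar>1 - norm z / norm a\<bar> \<le> norm (1 - z / a)" for a
        using norm_triangle_ineq3[of 1 "z / a"] by (simp add: norm_divide)
    qed
    have hi: "norm (\<Prod>a\<leftarrow>as. 1 - z / a) \<le> (\<Prod>b\<leftarrow>bs. 1 + norm z / b)" for z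
      unfolding P bs_def map_map o_def
    proof (rule prod_list_mono_nonneg(2))
      show "0 \<le> norm (1 - z / a) \<and> norm (1 - z / a) \<le> 1 + norm z / norm a" for a
        using norm_triangle_ineq4[of 1 "z / a"] by (simp add: norm_divide)
    qed
    \<comment> \<open>On the circle of radius \<open>\<rho> \<ge> 3 * R\<close> every factor has
      modulus at least \<open>\<rho> / b - 1 \<ge> 2\<close>. Dividing \<open>f\<close> by them
      bounds \<open>g\<close> there, and the maximum principle carries the bound inside. At
      \<open>w = 0\<close> this is a Jensen-type bound on the zeros.\<close>
    have out: "norm (g w) * (\<rho>^p * (\<Prod>b\<leftarrow>bs. \<rho> / b - 1)) \<le> max_modulus \<rho> f"
      if rho: "\<rho> \<ge> 3 * R" and w: "norm w \<le> \<rho>" for \<rho> w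
    proof -
      define Q where "Q = \<rho>^p * (\<Prod>b\<leftarrow>bs. \<rho> / b - 1)"
      have b2: "2 \<le> \<rho> / b - 1" if "b \<in> set bs" for b
        using bs that rho by (auto simp: field_simps)
      have "(\<Prod>b\<leftarrow>bs. \<rho> / b - 1) \<ge> (\<Prod>b\<leftarrow>bs. 1)"
        by (rule prod_list_mono_nonneg(2)) (use b2 in force)
      then have Q1: "(\<Prod>b\<leftarrow>bs. \<rho> / b - 1) \<ge> 1" by (simp add: map_replicate_const prod_list_replicate)
      have Q: "Q > 0" unfolding Q_def using Q1 rho R by simp
      have "norm (g v) \<le> max_modulus \<rho> f / Q" if v: "norm v = \<rho>" for v
      proof -
        have "(\<Prod>b\<leftarrow>bs. \<rho> / b - 1) \<le> (\<Prod>b\<leftarrow>bs. \<bar>1 - norm v / b\<bar>)"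
          by (rule prod_list_mono_nonneg(2)) (use b2 v in force)
        also have "\<dots> \<le> norm (\<Prod>a\<leftarrow>as. 1 - v / a)" by (rule lo)
        finally have "Q * norm (g v) \<le> \<rho> ^ p * norm (\<Prod>a\<leftarrow>as. 1 - v / a) * norm (g v)"
          unfolding Q_def using rho R by (intro mult_right_mono mult_left_mono) auto
        also have "\<dots> = norm (f v)" using v by (simp add: f1(3) g(3) norm_mult norm_power)
        also have "\<dots> \<le> max_modulus \<rho> f" by (rule norm_le_max_modulus[OF f]) (use v in simp)
        finally show ?thesis using Q by (simp add: field_simps)
      qed
      then have "norm (g w) \<le> max_modulus \<rho> f / Q" using norm_le_of_sphere[OF g(1) _ w] by blast
      then show ?thesis unfolding Q_def[symmetric] using Q by (simp add: field_simps)
    qed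
    \<comment> \<open>The added 1 provides the strict inequality that the Harnack estimate
      requires.\<close>
    define A where "A = ln (max_modulus (3 * R) f) + 1"
    have M3: "max_modulus (3 * R) f > 0" using max_modulus_pos[OF f nz] R by simp
    have gle: "norm (g w) \<le> max_modulus (3 * R) f" if w: "norm w \<le> 3 * R" for w
    proof -
      have "(\<Prod>b\<leftarrow>bs. 3 * R / b - 1) \<ge> (\<Prod>b\<leftarrow>bs. 1)"
        by (rule prod_list_mono_nonneg(2)) (use bs in \<open>force simp: field_simps\<close>)
      then have "1 \<le> (\<Prod>b\<leftarrow>bs. 3 * R / b - 1)" by (simp add: map_replicate_const prod_list_replicate)
      then have "1 * 1 \<le> (3 * R)^p * (\<Prod>b\<leftarrow>bs. 3 * R / b - 1)"
        using R by (intro mult_mono one_le_power) auto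
      then have "norm (g w) * 1 \<le> norm (g w) * ((3 * R)^p * (\<Prod>b\<leftarrow>bs. 3 * R / b - 1))"
        by (intro mult_left_mono) auto
      also have "\<dots> \<le> max_modulus (3 * R) f" using out[of "3 * R" w] w by simp
      finally show ?thesis by simp
    qed
    have lt: "norm (g w) < exp A" if w: "w \<in> ball 0 R" for w
    proof -
      have "norm (g w) \<le> exp (ln (max_modulus (3 * R) f))" using gle[of w] w R M3 by simp
      also have "\<dots> < exp A" by (simp add: A_def)
      finally show ?thesis .
    qed
    define u0 where "u0 = A - ln c"
    have u0: "u0 \<ge> 0"
    proof -
      have "exp (ln c) < exp A" using lt[of 0] g0 c R by simp
      then show ?thesis by (simp add: u0_def)
    qed
    have Eu: "E = 4 * u0 / R" using E by (simp add: u0_def A_def)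
    then have E0: "E \<ge> 0" using u0 R by simp
    have har: "c * exp (- E * norm z) \<le> norm (g z) \<and> norm (g z) \<le> c * exp (E * norm z)"
      if z: "norm z \<le> R / 2" for z
    proof -
      define s where "s = norm z / R"
      have s: "0 \<le> s" "s \<le> 1 / 2" using z R by (auto simp: s_def field_simps)
      define u where "u = A - ln (norm (g z))"
      have nzb: "g w \<noteq> 0" if "w \<in> ball 0 R" for w using g(4) that by simp
      have zs: "norm (z - 0) \<le> s * R" using R by (simp add: s_def)
      have hb: "g holomorphic_on ball 0 R" using g(1) holomorphic_on_subset by blast
      have H: "(1 - s) * u \<le> (1 + s) * u0" "(1 - s) * u0 \<le> (1 + s) * u"
        using harnack_ln_norm[OF hb nzb lt s(1) _ zs] s R by (auto simp: u_def u0_def g0)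
      have gz: "g z \<noteq> 0" using nzb[of z] z R by simp
      have zb: "z \<in> ball 0 R" using z R by simp
      have upos: "u \<ge> 0"
      proof -
        have "exp (ln (norm (g z))) < exp A" using lt[OF zb] gz by simp
        then show ?thesis by (simp add: u_def)
      qed
      \<comment> \<open>With \<open>s \<le> 1 / 2\<close>, dividing by \<open>1 - s\<close> costs at
        most a factor 2; the resulting \<open>4 * s * u0\<close> is exactly
        \<open>E * norm z\<close>, whence the 4 in \<open>E\<close>.\<close>
      have h2: "(1 - s) * (u - u0) \<le> 2 * s * u0" using H by (simp add: algebra_simps)
      have u1: "u - u0 \<le> 4 * s * u0"
      proof (rule ccontr)
        assume "\<not> ?thesis"
        then have "(1/2) * (4 * s * u0) < (1 - s) * (u - u0)"
          using s u0 by (intro mult_le_less_imp_less) auto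
        then show False using h2 by simp
      qed
      have h3: "u0 - u \<le> s * u0 + s * u" using H(2) by (simp add: algebra_simps)
      have u2: "u0 - u \<le> 4 * s * u0"
      proof (cases "u \<le> u0")
        case True
        then have "s * u \<le> s * u0" using s by (intro mult_left_mono)
        moreover have "s * u0 \<ge> 0" using s u0 by simp
        ultimately show ?thesis using h3 by linarith
      next
        case False
        moreover have "s * u0 \<ge> 0" using s u0 by simp
        ultimately show ?thesis by linarith
      qed
      have Es: "4 * s * u0 = E * norm z" using R by (simp add: Eu s_def)
      have "ln (norm (g z)) \<ge> ln c - E * norm z" "ln (norm (g z)) \<le> ln c + E * norm z"
        using u1 u2 unfolding Es by (auto simp: u_def u0_def)
      then have "exp (ln c - E * norm z) \<le> exp (ln (norm (g z)))"
        "exp (ln (norm (g z))) \<le> exp (ln c + E * norm z)" by (simp_all only: exp_le_cancel_iff)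
      moreover have "exp (ln c - E * norm z) = c * exp (- E * norm z)"
        using c by (simp add: exp_diff exp_minus divide_inverse)
      moreover have "exp (ln c + E * norm z) = c * exp (E * norm z)" using c by (simp add: exp_add)
      ultimately show ?thesis using gz by simp
    qed
    have fin: "c * norm z ^ p * (\<Prod>b\<leftarrow>bs. \<bar>1 - norm z / b\<bar>) * exp (- E * norm z) \<le> norm (f z) \<and>
          norm (f z) \<le> c * norm z ^ p * (\<Prod>b\<leftarrow>bs. 1 + norm z / b) * exp (E * norm z)"
      if z: "norm z \<le> R / 2" for z
    proof -
      have eq: "norm (f z) = norm z ^ p * (norm (\<Prod>a\<leftarrow>as. 1 - z / a) * norm (g z))"
        by (simp add: f1(3) g(3) norm_mult norm_power)
      have nn: "0 \<le> (\<Prod>b\<leftarrow>bs. \<bar>1 - norm z / b\<bar>)" by (rule prod_list_mono_nonneg(1)[where g="\<lambda>b. \<bar>1 - norm z / b\<bar>"]) auto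
      have nn2: "0 \<le> (\<Prod>b\<leftarrow>bs. 1 + norm z / b)" using hi[of z] norm_ge_zero order_trans by blast
      have "norm z ^ p * ((\<Prod>b\<leftarrow>bs. \<bar>1 - norm z / b\<bar>) * (c * exp (- E * norm z))) \<le> norm (f z)"
        unfolding eq using har[OF z] lo[of z] nn c by (intro mult_mono mult_nonneg_nonneg) auto
      moreover have "norm (f z) \<le> norm z ^ p * ((\<Prod>b\<leftarrow>bs. 1 + norm z / b) * (c * exp (E * norm z)))"
        unfolding eq using har[OF z] hi[of z] nn2 c by (intro mult_mono mult_nonneg_nonneg) auto
      ultimately show ?thesis by (simp add: mult_ac)
    qed
    have "\<forall>\<rho>\<ge>3*R. c * \<rho>^p * (\<Prod>b\<leftarrow>bs. \<rho> / b - 1) \<le> max_modulus \<rho> f"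
      using out[of _ 0] R g0 by (auto simp: mult.assoc)
    with E0 bs fin show ?case unfolding zero_split_def by blast
  qed
qed

text \<open>Under \<open>r = - w\<^sup>2\<close> the slit \<open>r > 0\<close> becomes the imaginary axis and negative \<open>r\<close> become real \<open>w\<close>. The term
  \<open>2 * sqrt R / (w + sqrt R)\<close> of the majorant, which is at least 1 on the part \<open>norm w \<le> sqrt R\<close> of the
  axis but 1/2 at \<open>3 * sqrt R\<close>, is what yields the factor 1/2.\<close>
lemma half_plane_bound:
  fixes c E R B X \<gamma> :: real and p :: nat and bs :: "real list"
  defines "G \<equiv> (\<lambda>r. c * r ^ p * (\<Prod>b\<leftarrow>bs. 1 + r / b) * exp (E * r))"
  assumes c: "c > 0" and E: "E \<ge> 0" and bs: "\<And>b. b \<in> set bs \<Longrightarrow> b > 0"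
    and \<gamma>: "0 < \<gamma>" "\<gamma> < 1" and R: "R > 0" and B: "B \<ge> 16" and X: "X \<ge> 0" and G1: "G R \<ge> 1"
    and small: "\<And>r. R \<le> r \<Longrightarrow> r \<le> B * R \<Longrightarrow>
      c * r ^ p * (\<Prod>b\<leftarrow>bs. \<bar>1 - r / b\<bar>) * exp (- E * r) \<le> exp X"
  shows "ln (G R) / 2 \<le> X + ln (G (B * R)) * ((4 / sqrt B) powr \<gamma> / cos (\<gamma> * pi / 2))"
proof -
  \<comment> \<open>A model function whose zeros other than 0 lie on the imaginary axis. On the real
    axis its modulus is \<open>G (x^2)\<close>; on the imaginary axis it is, with
    \<open>r = (norm w)^2\<close>, the product of the factors \<open>\<bar>1 - r / b\<bar>\<close>
    that \<open>small\<close> controls.\<close>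
  define \<Psi> where "\<Psi> w = of_real c * (- (w^2)) ^ p * (\<Prod>b\<leftarrow>bs. 1 + w^2 / of_real b) * exp (of_real E * w^2)"
    for w :: complex
  define \<rho> where "\<rho> = sqrt R"
  define S where "S = sqrt (B * R)"
  have rho: "\<rho> > 0" "\<rho>^2 = R" using R by (auto simp: \<rho>_def)
  have S: "S > 0" "S^2 = B * R" using R B by (auto simp: S_def)
  have Prodnn: "0 \<le> (\<Prod>b\<leftarrow>bs. 1 + r / b)" if "r \<ge> 0" for r
    by (rule prod_list_mono_nonneg(1)[where g="\<lambda>b. 1 + r / b"]) (use bs that in \<open>auto simp: less_imp_le\<close>)
  have Gmono: "G r \<le> G s" if "0 \<le> r" "r \<le> s" for r s
  proof -
    have "(\<Prod>b\<leftarrow>bs. 1 + r / b) \<le> (\<Prod>b\<leftarrow>bs. 1 + s / b)"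
      by (rule prod_list_mono_nonneg(2)) (use bs that in \<open>auto simp: divide_right_mono less_imp_le\<close>)
    then show ?thesis unfolding G_def using that c E Prodnn
      by (intro mult_mono power_mono mult_nonneg_nonneg) (auto simp: mult_left_mono)
  qed
  define Lr where "Lr = ln (G R)"
  define Y where "Y = ln (G (B * R))"
  have Lr: "Lr \<ge> 0" "G R = exp Lr" using G1 by (auto simp: Lr_def)
  have GB: "G (B * R) \<ge> G R" using R B by (intro Gmono) auto
  have Y: "Y \<ge> 0" "G (B * R) = exp Y" using GB G1 by (auto simp: Y_def)
  have Psi_le: "norm (\<Psi> w) \<le> G ((norm w)^2)" for w
  proof -
    have "norm (\<Prod>b\<leftarrow>bs. 1 + w^2 / of_real b) \<le> (\<Prod>b\<leftarrow>bs. 1 + (norm w)^2 / b)"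
      unfolding norm_prod_list_map
    proof (rule prod_list_mono_nonneg(2))
      show "0 \<le> norm (1 + w^2 / of_real b) \<and> norm (1 + w^2 / of_real b) \<le> 1 + (norm w)^2 / b"
        if "b \<in> set bs" for b
        using norm_triangle_ineq[of 1 "w^2 / of_real b"] bs[OF that] by (simp add: norm_divide norm_power)
    qed
    moreover have "norm (exp (of_real E * w^2)) \<le> exp (E * (norm w)^2)"
      using E complex_Re_le_cmod[of "w^2"] by (simp add: norm_power mult_left_mono)
    ultimately show ?thesis unfolding \<Psi>_def G_def norm_mult norm_power norm_minus_cancel
      using c Prodnn by (intro mult_mono mult_nonneg_nonneg) auto
  qed
  have Psi_im: "norm (\<Psi> w) = c * ((norm w)^2) ^ p * (\<Prod>b\<leftarrow>bs. \<bar>1 - (norm w)^2 / b\<bar>) * exp (- E * (norm w)^2)"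
    if w: "Re w = 0" for w
  proof -
    have w2: "w^2 = - of_real ((norm w)^2)"
      using w by (simp add: complex_eq_iff power2_eq_square cmod_def)
    have "norm (\<Prod>b\<leftarrow>bs. 1 + w^2 / of_real b) = (\<Prod>b\<leftarrow>bs. \<bar>1 - (norm w)^2 / b\<bar>)"
      unfolding norm_prod_list_map
    proof (intro arg_cong[where f=prod_list] map_cong refl)
      fix b assume "b \<in> set bs"
      have "1 + w^2 / of_real b = of_real (1 - (norm w)^2 / b)" unfolding w2 by simp
      then show "norm (1 + w^2 / of_real b) = \<bar>1 - (norm w)^2 / b\<bar>" by (simp only: norm_of_real)
    qed
    moreover have "norm (exp (of_real E * w^2)) = exp (- E * (norm w)^2)" unfolding w2 by simp
    moreover have "norm (- (w^2)) = (norm w)^2" by (simp add: norm_power)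
    ultimately show ?thesis using c unfolding \<Psi>_def by (simp add: norm_mult norm_power)
  qed
  have Psi_re: "norm (\<Psi> (of_real x)) = G (x^2)" for x :: real
  proof -
    have "norm (\<Prod>b\<leftarrow>bs. 1 + (of_real x)^2 / of_real b :: complex) = (\<Prod>b\<leftarrow>bs. 1 + x^2 / b)"
      unfolding norm_prod_list_map
    proof (intro arg_cong[where f=prod_list] map_cong refl)
      fix b assume b: "b \<in> set bs"
      have "1 + (of_real x)^2 / of_real b = (of_real (1 + x^2 / b) :: complex)" by simp
      moreover have "1 + x^2 / b \<ge> 0" using bs[OF b] by simp
      ultimately show "norm (1 + (of_real x)^2 / of_real b :: complex) = 1 + x^2 / b"
        by (metis norm_of_real abs_of_nonneg)
    qed
    then show ?thesis using c unfolding \<Psi>_def G_def by (simp add: norm_mult norm_power)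
  qed
  define cs where "cs = cos (\<gamma> * pi / 2)"
  have ang: "0 < \<gamma> * pi / 2" "\<gamma> * pi / 2 < pi / 2" using \<gamma> by auto
  have cs: "cs > 0" unfolding cs_def using ang by (intro cos_gt_zero) auto
  define Y' where "Y' = Y / (S powr \<gamma> * cs)"
  have Y': "Y' \<ge> 0" using Y cs by (simp add: Y'_def)
  \<comment> \<open>The real part of \<open>H\<close> is a harmonic majorant of
    \<open>ln (norm (\<Psi> w))\<close>, checked on the boundary of the half disc \<open>D\<close>:
    \<open>X\<close> serves the axis beyond \<open>\<rho>\<close>, the second term the axis up to
    \<open>\<rho>\<close>, the third the arc of radius \<open>S\<close>. Shifting by
    \<open>\<rho>\<close> keeps the pole and the branch cut outside \<open>D\<close>.\<close>
  define H where "H w = of_real X + of_real Lr * (of_real (2 * \<rho>) / (w + of_real \<rho>))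
       + of_real Y' * exp (of_real \<gamma> * Ln (w + of_real \<rho>))" for w
  define D where "D = {w::complex. 0 \<le> Re w \<and> norm w \<le> S}"
  have kern: "Re (of_real (2 * \<rho>) / (w + of_real \<rho>)) = 2 * \<rho> * (Re w + \<rho>) / (norm (w + of_real \<rho>))^2" for w
    by (simp add: Re_divide cmod_power2)
  have kern0: "Re (of_real (2 * \<rho>) / (w + of_real \<rho>)) \<ge> 0" if "Re w \<ge> 0" for w
    unfolding kern using that rho by simp
  \<comment> \<open>Because \<open>\<gamma> < 1\<close>, the real part of \<open>v powr \<gamma>\<close> is bounded below on the whole arc, corners included.\<close>
  have pw: "Re (exp (of_real \<gamma> * Ln (w + of_real \<rho>))) \<ge> (norm w) powr \<gamma> * cs" if w: "Re w \<ge> 0" for w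
  proof -
    define v where "v = w + of_real \<rho>"
    have v: "Re v > 0" using w rho by (simp add: v_def)
    then have v0: "v \<noteq> 0" by auto
    have nv: "norm w \<le> norm v"
    proof -
      have "(norm w)^2 \<le> (norm v)^2" using w rho unfolding v_def cmod_power2 by (simp add: power_mono)
      then show ?thesis by (rule power2_le_imp_le) simp
    qed
    have "\<bar>Im (Ln v)\<bar> < pi / 2" using Re_Ln_pos_lt[OF v0] v by simp
    then have "\<bar>\<gamma> * Im (Ln v)\<bar> \<le> \<gamma> * pi / 2" using \<gamma> by (simp add: abs_mult)
    then have "cos (\<gamma> * pi / 2) \<le> cos \<bar>\<gamma> * Im (Ln v)\<bar>"
      using ang by (intro cos_monotone_0_pi_le) auto
    then have cc: "cs \<le> cos (\<gamma> * Im (Ln v))" by (simp add: cs_def)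
    have "Re (exp (of_real \<gamma> * Ln v)) = (norm v) powr \<gamma> * cos (\<gamma> * Im (Ln v))"
      using v0 by (simp add: Re_exp powr_def)
    moreover have "(norm w) powr \<gamma> * cs \<le> (norm v) powr \<gamma> * cos (\<gamma> * Im (Ln v))"
      using nv cc cs \<gamma> by (intro mult_mono powr_mono2) auto
    ultimately show ?thesis by (simp add: v_def)
  qed
  have pw0: "Re (exp (of_real \<gamma> * Ln (w + of_real \<rho>))) \<ge> 0" if "Re w \<ge> 0" for w
    using pw[OF that] cs by (meson mult_nonneg_nonneg order.strict_implies_order order_trans powr_ge_zero)
  have ReH: "Re (H w) = X + Lr * Re (of_real (2 * \<rho>) / (w + of_real \<rho>)) + Y' * Re (exp (of_real \<gamma> * Ln (w + of_real \<rho>)))" for w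
  proof -
    have "Re (of_real r * z) = r * Re z" for r z by simp
    then show ?thesis unfolding H_def plus_complex.sel by (simp only: Re_complex_of_real)
  qed
  have quot: "norm (\<Psi> w * exp (- H w)) = norm (\<Psi> w) / exp (Re (H w))" for w
    unfolding norm_mult exp_minus norm_inverse norm_exp_eq_Re by (simp only: divide_inverse)
  have clD: "closed D"
    unfolding D_def Collect_conj_eq
    by (intro closed_Int closed_Collect_le continuous_intros)
  have hol: "(\<lambda>w. \<Psi> w * exp (- H w)) holomorphic_on D"
  proof -
    have nonneg: "w + of_real \<rho> \<noteq> 0" "w + of_real \<rho> \<notin> \<real>\<^sub>\<le>\<^sub>0" if "w \<in> D" for w
    proof -
      have "Re (w + of_real \<rho>) > 0" using that rho by (simp add: D_def)
      then show "w + of_real \<rho> \<noteq> 0" "w + of_real \<rho> \<notin> \<real>\<^sub>\<le>\<^sub>0"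
        by (metis zero_complex.sel(1) less_irrefl, simp add: complex_nonpos_Reals_iff)
    qed
    have "(\<lambda>w. \<Prod>b\<leftarrow>bs'. 1 + w\<^sup>2 / complex_of_real b) holomorphic_on D"
      if "set bs' \<subseteq> set bs" for bs'
      using that
    proof (induction bs')
      case (Cons b bs')
      then have "b \<noteq> 0" using bs[of b] by auto
      with Cons show ?case by (auto intro!: holomorphic_intros)
    qed simp
    then have "(\<lambda>w. \<Prod>b\<leftarrow>bs. 1 + w\<^sup>2 / complex_of_real b) holomorphic_on D" by blast
    then show ?thesis unfolding \<Psi>_def H_def using nonneg
      by (intro holomorphic_intros) auto
  qed
  have B4: "sqrt B \<ge> 4" using B real_le_rsqrt[of 4 B] by simp
  have S4: "S = sqrt B * \<rho>" by (simp add: S_def \<rho>_def real_sqrt_mult)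
  \<comment> \<open>As \<open>sqrt B \<ge> 4\<close>, this point lies in \<open>D\<close>; there the
    modulus of \<open>\<Psi>\<close> is \<open>G (9 * R)\<close>, which dominates
    \<open>G R\<close>.\<close>
  define w0 where "w0 = complex_of_real (3 * \<rho>)"
  have "norm (\<Psi> w0 * exp (- H w0)) \<le> 1"
  proof (rule maximum_modulus_frontier[of "\<lambda>w. \<Psi> w * exp (- H w)" D])
    show "(\<lambda>w. \<Psi> w * exp (- H w)) holomorphic_on interior D"
      using hol holomorphic_on_subset interior_subset by blast
    show "continuous_on (closure D) (\<lambda>w. \<Psi> w * exp (- H w))"
      using hol clD holomorphic_on_imp_continuous_on by simp
    show "bounded D" unfolding D_def by (auto simp: bounded_iff)
    have "3 * \<rho> \<le> sqrt B * \<rho>" using B4 rho by (intro mult_right_mono) auto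
    then show "w0 \<in> D" using rho unfolding D_def w0_def S4 by simp
    show "norm (\<Psi> w * exp (- H w)) \<le> 1" if w: "w \<in> frontier D" for w
    proof -
      have "{w::complex. 0 < Re w \<and> norm w < S} \<subseteq> interior D"
      proof (rule interior_maximal)
        show "open {w::complex. 0 < Re w \<and> norm w < S}"
          unfolding Collect_conj_eq by (intro open_Int open_Collect_less continuous_intros)
      qed (auto simp: D_def)
      moreover have wD: "w \<in> D" and "w \<notin> interior D" using w clD by (auto simp: frontier_def)
      ultimately have alt: "Re w = 0 \<or> norm w = S" unfolding D_def by force
      have Rew: "Re w \<ge> 0" and nw: "norm w \<le> S" using wD by (auto simp: D_def)
      have nn: "Lr * Re (of_real (2 * \<rho>) / (w + of_real \<rho>)) \<ge> 0"
        "Y' * Re (exp (of_real \<gamma> * Ln (w + of_real \<rho>))) \<ge> 0"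
        using kern0[OF Rew] pw0[OF Rew] Lr Y' by auto
      have "norm (\<Psi> w) \<le> exp (Re (H w))"
      proof (cases "norm w = S")
        case True
        have "Y = Y' * (S powr \<gamma> * cs)" using S cs by (simp add: Y'_def)
        also have "\<dots> \<le> Y' * Re (exp (of_real \<gamma> * Ln (w + of_real \<rho>)))"
          using pw[OF Rew] Y' True by (intro mult_left_mono) auto
        finally have "Y \<le> Re (H w)" unfolding ReH using nn X by linarith
        then have "exp Y \<le> exp (Re (H w))" by simp
        moreover have "norm (\<Psi> w) \<le> exp Y" using Psi_le[of w] True S Y by simp
        ultimately show ?thesis by (rule order_trans[rotated])
      next
        case False
        then have Re0: "Re w = 0" using alt by simp
        show ?thesis
        proof (cases "norm w \<le> \<rho>")
          case True
          have n2: "(norm (w + of_real \<rho>))^2 = (norm w)^2 + \<rho>^2" using Re0 by (simp add: cmod_power2)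
          have "(norm w)^2 \<le> \<rho>^2" using True by (intro power_mono) auto
          moreover have "(norm w)^2 + \<rho>^2 > 0" using rho by (intro add_nonneg_pos) auto
          ultimately have "1 \<le> Re (of_real (2 * \<rho>) / (w + of_real \<rho>))"
            unfolding kern n2 using Re0 by (simp add: power2_eq_square)
          then have "Lr * 1 \<le> Lr * Re (of_real (2 * \<rho>) / (w + of_real \<rho>))"
            using Lr by (intro mult_left_mono)
          then have "Lr \<le> Re (H w)" unfolding ReH using nn X by linarith
          then have "G R \<le> exp (Re (H w))" using Lr(2) by simp
          moreover have "norm (\<Psi> w) \<le> G R"
            using Psi_le[of w] Gmono[of "(norm w)^2" R] \<open>(norm w)^2 \<le> \<rho>^2\<close> rho by simp
          ultimately show ?thesis by (rule order_trans[rotated])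
        next
          case False
          have "\<rho>^2 \<le> (norm w)^2" using False rho by (intro power_mono) auto
          moreover have "(norm w)^2 \<le> S^2" using nw by (intro power_mono) auto
          ultimately have "norm (\<Psi> w) \<le> exp X" unfolding Psi_im[OF Re0]
            using small[of "(norm w)^2"] rho S by simp
          moreover have "exp X \<le> exp (Re (H w))" unfolding ReH exp_le_cancel_iff using nn by linarith
          ultimately show ?thesis by (rule order_trans)
        qed
      qed
      then show ?thesis unfolding quot by simp
    qed
  qed
  then have le1: "G ((3 * \<rho>)^2) \<le> exp (Re (H w0))"
    using Psi_re[of "3 * \<rho>"] unfolding w0_def[symmetric]
    unfolding quot by simp
  have "R \<le> (3 * \<rho>)^2" using rho R by (simp add: power_mult_distrib)
  then have "G R \<le> G ((3 * \<rho>)^2)" using R by (intro Gmono) auto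
  then have "G R \<le> exp (Re (H w0))" using le1 by (rule order_trans)
  then have "exp Lr \<le> exp (Re (H w0))" unfolding Lr(2) .
  then have fin: "Lr \<le> Re (H w0)" by simp
  have w0r: "w0 + of_real \<rho> = of_real (4 * \<rho>)" by (simp add: w0_def)
  have k1: "Re (of_real (2 * \<rho>) / (w0 + of_real \<rho>)) = 1 / 2"
    unfolding w0r of_real_divide[symmetric] using rho by simp
  have "exp (of_real \<gamma> * Ln (w0 + of_real \<rho>)) = complex_of_real (exp (\<gamma> * ln (4 * \<rho>)))"
    unfolding w0r using rho by (subst Ln_of_real) (auto simp: exp_of_real[symmetric])
  then have k2: "Re (exp (of_real \<gamma> * Ln (w0 + of_real \<rho>))) = (4 * \<rho>) powr \<gamma>"
    using rho by (simp add: powr_def)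
  have "Y' * (4 * \<rho>) powr \<gamma> = Y * (((4 * \<rho>) powr \<gamma> / S powr \<gamma>) / cs)"
    by (simp add: Y'_def)
  also have "(4 * \<rho>) powr \<gamma> / S powr \<gamma> = (4 * \<rho> / S) powr \<gamma>"
    using rho S by (simp add: powr_divide)
  also have "4 * \<rho> / S = 4 / sqrt B" using rho unfolding S4 by simp
  finally have "Y' * (4 * \<rho>) powr \<gamma> = Y * ((4 / sqrt B) powr \<gamma> / cs)" .
  moreover have "Lr \<le> X + Lr * (1 / 2) + Y' * (4 * \<rho>) powr \<gamma>" using fin unfolding ReH k1 k2 .
  ultimately show ?thesis unfolding Lr_def[symmetric] Y_def[symmetric] cs_def[symmetric] by linarith
qed

section \<open>Averages of logarithms and large values of products\<close>

lemma continuous_on_x_ln_abs: "continuous_on S (\<lambda>x::real. x * ln \<bar>x\<bar>)"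
proof -
  have "isCont (\<lambda>x::real. x * ln \<bar>x\<bar>) x" for x
  proof (cases "x = 0")
    case True
    have "((\<lambda>x::real. x * ln \<bar>x\<bar>) \<longlongrightarrow> 0) (at_right 0)" "((\<lambda>x::real. x * ln \<bar>x\<bar>) \<longlongrightarrow> 0) (at_left 0)"
      by real_asymp+
    then show ?thesis using True by (simp add: isCont_def filterlim_at_split)
  next
    case False
    then show ?thesis by (intro continuous_intros) auto
  qed
  then show ?thesis by (simp add: continuous_at_imp_continuous_on)
qed

text \<open>The antiderivative \<open>F\<close> is continuous across the singularity at
  \<open>\<beta>\<close>, so the fundamental theorem applies with one exceptional point. The lower
  bound, uniform in \<open>\<beta>\<close>, is the value for \<open>\<beta>\<close> at the midpoint
  of the interval.\<close>

lemma integral_ln_abs: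
  fixes a b \<beta> :: real
  assumes "a < b"
  obtains I where "((\<lambda>x. ln \<bar>x - \<beta>\<bar>) has_integral I) {a..b}" "I \<ge> (b - a) * (ln ((b - a) / 2) - 1)"
proof -
  define F where "F x = (x - \<beta>) * ln \<bar>x - \<beta>\<bar> - (x - \<beta>)" for x
  have cont: "continuous_on {a..b} F"
  proof -
    have "continuous_on {a..b} ((\<lambda>x. x * ln \<bar>x\<bar>) \<circ> (\<lambda>x. x - \<beta>))"
      by (intro continuous_on_compose continuous_on_x_ln_abs continuous_intros)
    from continuous_on_diff[OF this, of "\<lambda>x. x - \<beta>"] show ?thesis
      unfolding F_def o_def by (simp add: continuous_on_diff continuous_on_id)
  qed
  have der: "(F has_vector_derivative ln \<bar>x - \<beta>\<bar>) (at x)" if "x \<in> {a<..<b} - {\<beta>}" for x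
  proof -
    have x: "x - \<beta> \<noteq> 0" using that by auto
    have "(F has_real_derivative ln \<bar>x - \<beta>\<bar>) (at x)"
    proof (cases "x > \<beta>")
      case True
      have "((\<lambda>x. (x - \<beta>) * ln (x - \<beta>) - (x - \<beta>)) has_real_derivative ln \<bar>x - \<beta>\<bar>) (at x)"
        using True by (auto intro!: derivative_eq_intros)
      then show ?thesis
        by (rule has_field_derivative_transform_within_open[of _ _ _ "{\<beta><..}"]) (use True in \<open>auto simp: F_def\<close>)
    next
      case False
      then have "x < \<beta>" using x by auto
      have "((\<lambda>x. (\<beta> - x) - (\<beta> - x) * ln (\<beta> - x)) has_real_derivative ln \<bar>x - \<beta>\<bar>) (at x)"
        using \<open>x < \<beta>\<close> by (auto intro!: derivative_eq_intros)
      then show ?thesis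
        by (rule has_field_derivative_transform_within_open[of _ _ _ "{..<\<beta>}"]) (use \<open>x < \<beta>\<close> in \<open>auto simp: F_def algebra_simps\<close>)
    qed
    then show ?thesis by (simp add: has_real_derivative_iff_has_vector_derivative)
  qed
  have int: "((\<lambda>x. ln \<bar>x - \<beta>\<bar>) has_integral (F b - F a)) {a..b}"
    by (rule fundamental_theorem_of_calculus_interior_strong[of "{\<beta>}"]) (use assms der cont in auto)
  define l where "l = b - a"
  have l: "l > 0" using assms by (simp add: l_def)
  \<comment> \<open>For \<open>\<beta>\<close> inside the interval: midpoint convexity of
    \<open>x * ln x\<close>, obtained by adding the tangent-line bounds at \<open>m\<close> for the
    two arguments.\<close>
  have key: "x * ln x + y * ln y \<ge> (x + y) * ln ((x + y) / 2)" if "x \<ge> 0" "y \<ge> 0" "x + y > 0" for x y :: real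
  proof -
    define m where "m = (x + y) / 2"
    have m: "m > 0" using that by (simp add: m_def)
    have *: "u * ln u \<ge> u * ln m + u - m" if "u \<ge> 0" for u
    proof (cases "u = 0")
      case False
      then have u: "u > 0" using that by simp
      have "ln (m / u) \<le> m / u - 1" using u m by (intro ln_le_minus_one) auto
      then have "u * (ln m - ln u) \<le> u * (m / u - 1)" using u m by (intro mult_left_mono) (auto simp: ln_div)
      then show ?thesis using u by (simp add: algebra_simps)
    qed (use m in auto)
    have "(x + y) * ln m = x * ln m + y * ln m" "x + y = 2 * m" by (auto simp: distrib_right m_def)
    then show ?thesis using *[OF that(1)] *[OF that(2)] unfolding m_def[symmetric] by linarith
  qed
  \<comment> \<open>For \<open>\<beta>\<close> outside the interval, at distance \<open>s\<close>
    from its nearer end.\<close>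
  have key2: "(l + s) * ln (l + s) - s * ln s \<ge> l * ln (l / 2)" if "s \<ge> 0" for s :: real
  proof -
    have "s * ln s \<le> s * ln (l + s)"
      using that l by (cases "s = 0") (auto intro!: mult_left_mono)
    moreover have "l * ln (l / 2) \<le> l * ln (l + s)" using that l by (intro mult_left_mono ln_mono) auto
    ultimately show ?thesis by (simp add: distrib_right)
  qed
  have "(b - \<beta>) * ln \<bar>b - \<beta>\<bar> - (a - \<beta>) * ln \<bar>a - \<beta>\<bar> \<ge> l * ln (l / 2)"
  proof -
    consider "\<beta> \<le> a" | "a \<le> \<beta>" "\<beta> \<le> b" | "b \<le> \<beta>" by linarith
    then show ?thesis
    proof cases
      case 1
      then show ?thesis using key2[of "a - \<beta>"] assms by (simp add: l_def)
    next
      case 2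
      then show ?thesis using key[of "b - \<beta>" "\<beta> - a"] assms by (simp add: l_def algebra_simps)
    next
      case 3
      then show ?thesis using key2[of "\<beta> - b"] assms by (simp add: l_def algebra_simps)
    qed
  qed
  then have "F b - F a \<ge> (b - a) * (ln ((b - a) / 2) - 1)"
    unfolding F_def l_def by (simp add: algebra_simps)
  with int show ?thesis by (rule that)
qed

text \<open>A Cartan-type estimate by averaging: if the product were small for every
  \<open>r\<close>, the integral of the sum of \<open>ln \<bar>r - \<beta>\<bar>\<close> would fall
  below the sum of the individual lower bounds. The constant 4 instead of 2 leaves the gap
  \<open>K < K'\<close> needed for the contradiction.\<close>

lemma exists_large_product:
  fixes a b :: real and bs :: "real list"
  assumes "a < b"
  shows "\<exists>r\<in>{a..b}. ((b - a) / (4 * exp 1)) ^ length bs \<le> (\<Prod>\<beta>\<leftarrow>bs. \<bar>r - \<beta>\<bar>)"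
proof (cases "bs = []")
  case True
  then show ?thesis using assms by (auto intro!: bexI[of _ a])
next
  case False
  show ?thesis
  proof (rule ccontr)
    assume neg: "\<not> ?thesis"
    define K where "K = ln ((b - a) / 4) - 1"
    define K' where "K' = ln ((b - a) / 2) - 1"
    have KK: "K < K'" using assms unfolding K_def K'_def by (simp add: ln_less_cancel_iff)
    define s where "s r = (\<Sum>\<beta>\<leftarrow>bs. ln \<bar>r - \<beta>\<bar>)" for r
    have K: "(b - a) / (4 * exp 1) = exp K" using assms by (simp add: K_def exp_diff)
    have prod: "(\<Prod>\<beta>\<leftarrow>xs. \<bar>r - \<beta>\<bar>) = exp (\<Sum>\<beta>\<leftarrow>xs. ln \<bar>r - \<beta>\<bar>)" if "r \<notin> set xs" for r and xs :: "real list"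
      using that by (induction xs) (auto simp: exp_add)
    have lt: "s r \<le> real (length bs) * K" if "r \<in> {a..b}" "r \<notin> set bs" for r
    proof -
      have "exp (s r) < exp K ^ length bs"
        using neg that prod[OF that(2)] unfolding K s_def by force
      then show ?thesis by (simp add: exp_of_nat_mult[symmetric])
    qed
    have "\<exists>I. ((\<lambda>r. \<Sum>\<beta>\<leftarrow>xs. ln \<bar>r - \<beta>\<bar>) has_integral I) {a..b} \<and> I \<ge> real (length xs) * ((b - a) * K')" for xs
    proof (induction xs)
      case Nil
      then show ?case by (auto intro!: exI[of _ 0])
    next
      case (Cons \<beta> xs)
      then obtain I where I: "((\<lambda>r. \<Sum>\<beta>\<leftarrow>xs. ln \<bar>r - \<beta>\<bar>) has_integral I) {a..b}" "I \<ge> real (length xs) * ((b - a) * K')" by blast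
      obtain J where J: "((\<lambda>r. ln \<bar>r - \<beta>\<bar>) has_integral J) {a..b}" "J \<ge> (b - a) * K'"
        unfolding K'_def by (rule integral_ln_abs[OF assms])
      show ?case using has_integral_add[OF J(1) I(1)] J(2) I(2)
        by (intro exI[of _ "J + I"]) (simp add: distrib_right)
    qed
    then obtain I where I: "(s has_integral I) {a..b}" "I \<ge> real (length bs) * ((b - a) * K')"
      unfolding s_def by blast
    \<comment> \<open>At the finitely many \<open>r\<close> in \<open>bs\<close> a logarithm takes
      its default value at 0, so \<open>lt\<close> says nothing there; changing the integrand at
      these points leaves the integral alone.\<close>
    define g where "g r = (if r \<in> set bs then real (length bs) * K else s r)" for r
    have gI: "(g has_integral I) {a..b}"
      by (rule has_integral_spike_finite[OF _ _ I(1), of "set bs"]) (auto simp: g_def)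
    have "((\<lambda>_. real (length bs) * K) has_integral (b - a) * (real (length bs) * K)) {a..b}"
      using has_integral_const_real[of "real (length bs) * K" a b] assms by simp
    then have "I \<le> (b - a) * (real (length bs) * K)"
      by (rule has_integral_le[OF gI]) (use lt in \<open>auto simp: g_def\<close>)
    moreover have "(b - a) * (real (length bs) * K) < real (length bs) * ((b - a) * K')"
      using assms False KK by simp
    ultimately show False using I by simp
  qed
qed

subsection \<open>Minimum modulus under regular growth\<close>

locale regular_growth =
  fixes f :: "complex \<Rightarrow> complex" and M1 D1 D2 :: real
  assumes trans: "transcendental_entire f"
    and M1: "M1 > 0" and D1: "D1 > 1" and D2: "D2 > 1" and D12: "D1 > D2\<^sup>2"
    and growth: "\<And>r. r \<ge> M1 \<Longrightarrow> ln (max_modulus (D1 * r) f) < D2 * ln (max_modulus r f)"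
begin

section \<open>Positivity, convexity and superlinear growth of \<open>L\<close>\<close>

definition L :: "real \<Rightarrow> real" where "L t = ln (max_modulus (exp t) f)"

lemma holo: "f holomorphic_on UNIV"
  using trans by (simp add: transcendental_entire_def)

lemma nonzero: obtains z where "f z \<noteq> 0"
  using trans unfolding transcendental_entire_def by (metis poly_0)

lemma max_modulus_exp: "max_modulus (exp t) f = exp (L t)"
proof -
  obtain z where "f z \<noteq> 0" by (rule nonzero)
  then show ?thesis unfolding L_def using max_modulus_pos[OF holo, of z "exp t"] by simp
qed

lemma max_modulus_L: "r > 0 \<Longrightarrow> max_modulus r f = exp (L (ln r))"
  using max_modulus_exp[of "ln r"] by simp

lemma norm_le_exp_L: "norm z \<le> exp t \<Longrightarrow> norm (f z) \<le> exp (L t)"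
  using norm_le_max_modulus[OF holo, of z "exp t"] by (simp add: max_modulus_exp)

lemma L_mono: "s \<le> t \<Longrightarrow> L s \<le> L t"
  using max_modulus_mono[OF holo, of "exp s" "exp t"] by (simp add: max_modulus_exp)

lemma L_shift: "t \<ge> ln M1 \<Longrightarrow> L (t + ln D1) < D2 * L t"
proof -
  assume "t \<ge> ln M1"
  then have "exp t \<ge> M1" using M1 by (metis exp_le_cancel_iff exp_ln)
  then have "ln (max_modulus (D1 * exp t) f) < D2 * L t" unfolding L_def by (rule growth)
  then show ?thesis using D1 by (simp add: L_def exp_add mult.commute)
qed

text \<open>Monotonicity and the growth condition give \<open>L t < D2 * L t\<close>, which with
  \<open>D2 > 1\<close> forces a positive value.\<close>

lemma L_pos:
  assumes "t \<ge> ln M1"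
  shows "L t > 0"
proof -
  have "L t \<le> L (t + ln D1)" using D1 by (intro L_mono) simp
  then have "(D2 - 1) * L t > 0" using L_shift[OF assms] by (simp add: left_diff_distrib)
  then show ?thesis using D2 by (simp add: zero_less_mult_iff)
qed

lemma L_shift_iter:
  assumes "t \<ge> ln M1"
  shows "L (t + real k * ln D1) \<le> D2 ^ k * L t"
proof (induction k)
  case (Suc k)
  have "ln M1 \<le> t + real k * ln D1" using assms D1 by (simp add: add_increasing2)
  from L_shift[OF this] have "L (t + real (Suc k) * ln D1) \<le> D2 * L (t + real k * ln D1)"
    by (simp add: algebra_simps)
  also have "\<dots> \<le> D2 * (D2 ^ k * L t)" using Suc D2 by (intro mult_left_mono) auto
  finally show ?case by (simp add: mult.assoc)
qed simp

lemma L_convex: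
  assumes "0 \<le> t" "t \<le> T" "0 < T"
  shows "T * (L t - L 0) \<le> t * (L T - L 0)"
proof -
  obtain z where "f z \<noteq> 0" by (rule nonzero)
  from three_circles[OF holo this assms] show ?thesis by (simp add: L_def)
qed

text \<open>Convexity, with \<open>L 0\<close> replaced by its absolute value: since
  \<open>T / t \<ge> 1\<close>, subtracting \<open>\<bar>L 0\<bar>\<close> inside the product
  absorbs \<open>L 0\<close> whatever its sign.\<close>

lemma L_ge_linear:
  assumes "0 < t" "t \<le> T"
  shows "L T \<ge> (T / t) * (L t - \<bar>L 0\<bar>)"
proof -
  have "T * (L t - L 0) \<le> t * (L T - L 0)" using assms by (intro L_convex) auto
  then have 1: "(T / t) * (L t - L 0) \<le> L T - L 0" using assms by (simp add: field_simps)
  have q: "T / t \<ge> 1" using assms by simp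
  define v where "v = \<bar>L 0\<bar> - L 0"
  have "v \<ge> 0" "L 0 + v \<ge> 0" by (auto simp: v_def)
  moreover from this have "1 * v \<le> (T / t) * v" using q by (intro mult_right_mono) auto
  ultimately have "L 0 + (T / t) * v \<ge> 0" by linarith
  moreover have "(T / t) * (L t - \<bar>L 0\<bar>) = (T / t) * (L t - L 0) - (T / t) * v"
    by (simp add: v_def algebra_simps)
  ultimately show ?thesis using 1 by linarith
qed

text \<open>Failure would give \<open>L T < A * T\<close> for arbitrarily large \<open>T\<close>.
  Convexity spreads a linear bound to all \<open>t \<ge> 1\<close>, so \<open>f\<close> grows
  polynomially and Liouville's theorem makes it a polynomial.\<close>

lemma L_superlinear: "\<exists>t0. \<forall>t\<ge>t0. L t \<ge> A * t"
proof (rule ccontr)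
  assume "\<not> ?thesis"
  then have neg: "\<exists>t\<ge>t0. L t < A * t" for t0 by (meson not_le)
  obtain n :: nat where n: "real n \<ge> A + \<bar>L 0\<bar>" using real_arch_simple by blast
  have bound: "L t \<le> L 0 + real n * t" if "t \<ge> 1" for t
  proof -
    obtain T where T: "T \<ge> t" "L T < A * T" using neg by blast
    have "T * (L t - L 0) \<le> t * (L T - L 0)" using T that by (intro L_convex) auto
    also have "\<dots> \<le> t * (T * real n)"
    proof (rule mult_left_mono)
      have "\<bar>L 0\<bar> \<le> T * \<bar>L 0\<bar>" using T that mult_right_mono[of 1 T "\<bar>L 0\<bar>"] by simp
      moreover have "T * (A + \<bar>L 0\<bar>) \<le> T * real n" using n T that by (intro mult_left_mono) auto
      ultimately show "L T - L 0 \<le> T * real n" using T by (simp add: algebra_simps)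
    qed (use that in simp)
    finally have "T * (L t - L 0) \<le> T * (real n * t)" by (simp add: mult_ac)
    then show ?thesis using T that by (simp add: mult_le_cancel_left)
  qed
  have nof: "norm (f z) \<le> exp (L 0) * norm z ^ n" if "exp 1 \<le> norm z" for z
  proof -
    have pos: "norm z > 0" using that exp_gt_zero less_le_trans by blast
    then have "1 \<le> ln (norm z)" using that by (simp add: ln_ge_iff)
    then have "exp (L (ln (norm z))) \<le> exp (L 0 + real n * ln (norm z))"
      using bound by simp
    moreover have "norm (f z) \<le> exp (L (ln (norm z)))" using pos by (intro norm_le_exp_L) simp
    ultimately show ?thesis using pos by (simp add: exp_add exp_of_nat_mult)
  qed
  have "f z = poly (\<Sum>k\<le>n. monom ((deriv ^^ k) f 0 / fact k) k :: complex poly) z" for z :: complex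
    using Liouville_polynomial[OF holo, of "exp 1" "exp (L 0)" n z] nof by (simp add: poly_sum poly_monom)
  then show False using trans unfolding transcendental_entire_def by blast
qed

lemma L_eventually_ge: "\<forall>\<^sub>F t in at_top. L t \<ge> A * t"
  using L_superlinear unfolding eventually_at_top_linorder .

lemma L_at_top: "filterlim L at_top at_top"
proof (rule filterlim_at_top_mono[OF _ L_eventually_ge[of 1]])
  show "filterlim (\<lambda>x::real. 1 * x) at_top at_top" by (simp add: filterlim_ident)
qed

text \<open>The half-plane estimate needs an exponent \<open>\<gamma> < 1\<close> with \<open>D1 powr \<gamma> > D2\<^sup>2\<close>; this is where
  \<open>D1 > D2\<^sup>2\<close> enters.\<close>
lemma minimum_modulus_power:
  obtains \<kappa> T0 where "\<kappa> > 0"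
    "\<And>T. T \<ge> T0 \<Longrightarrow> \<exists>t. T / 2 \<le> t \<and> t \<le> T \<and> (\<forall>z. norm z = exp t \<longrightarrow> exp (\<kappa> * L T) \<le> norm (f z))"
proof -
  obtain z1 where z1: "f z1 \<noteq> 0" by (rule nonzero)
  obtain p :: nat and c :: real where c: "c > 0" and dec:
    "\<And>R E. R \<ge> 1 \<Longrightarrow> E = 4 * (ln (max_modulus (3 * R) f) + 1 - ln c) / R \<Longrightarrow>
      E \<ge> 0 \<and> (\<exists>bs. zero_split f p c R E bs)"
    by (rule zero_decomposition[OF holo z1]) (rule that)
  define d where "d = ln D1"
  have d: "d > 0" using D1 by (simp add: d_def)
  define a where "a = 2 * ln D2 / d"
  have "ln (D2^2) < ln D1" using D12 D2 D1 by (subst ln_less_cancel_iff) auto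
  then have a: "0 < a" "a < 1" using D2 d by (auto simp: a_def ln_realpow d_def)
  define \<gamma> where "\<gamma> = (a + 1) / 2"
  have \<gamma>: "0 < \<gamma>" "\<gamma> < 1" "a < \<gamma>" using a by (auto simp: \<gamma>_def)
  \<comment> \<open>Enlarging \<open>B\<close> by a factor \<open>D1\<close> raises \<open>L\<close>
    by a factor of at most \<open>D2\<close> and multiplies the arc weight
    \<open>(4 / sqrt B) powr \<gamma>\<close> by \<open>exp (- \<gamma> * d / 2)\<close>;
    \<open>q\<close> is the net factor, below 1 by the choice of \<open>\<gamma>\<close>.\<close>
  define q where "q = D2 * exp (- \<gamma> * d / 2)"
  have q: "0 < q" "q < 1"
  proof -
    have "ln D2 - \<gamma> * d / 2 < 0" using \<gamma>(3) d by (simp add: a_def field_simps)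
    then have "exp (ln D2 - \<gamma> * d / 2) < 1" by simp
    moreover have "exp (ln D2 - \<gamma> * d / 2) = exp (ln D2) * exp (- \<gamma> * d / 2)"
      unfolding exp_add[symmetric] by simp
    then have "exp (ln D2 - \<gamma> * d / 2) = q" using D2 by (simp add: q_def)
    ultimately show "q < 1" by simp
    show "0 < q" using D2 by (simp add: q_def)
  qed
  \<comment> \<open>The shift by \<open>ln 6\<close>, coming from the radius
    \<open>3 * R1 = 6 * exp T\<close>, is covered by \<open>j\<close> steps of length
    \<open>ln D1\<close>.\<close>
  obtain j :: nat where j: "real j * d \<ge> ln 6" using reals_Archimedean3[OF d] less_imp_le by metis
  define cs where "cs = cos (\<gamma> * pi / 2)"
  have cs: "cs > 0" unfolding cs_def using \<gamma> by (intro cos_gt_zero) auto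
  define C where "C = 4 * D2 ^ j * (4 powr \<gamma> / cs)"
  have C: "C > 0" using D2 cs by (simp add: C_def)
  obtain k0 where k0: "\<And>k. k \<ge> k0 \<Longrightarrow> q ^ k < 1 / (4 * C)"
  proof -
    have "(\<lambda>k. q ^ k) \<longlonglongrightarrow> 0" using q by (intro LIMSEQ_realpow_zero) auto
    then have "\<forall>\<^sub>F k in sequentially. q ^ k < 1 / (4 * C)" using C by (intro order_tendstoD) auto
    then show ?thesis using that unfolding eventually_sequentially by blast
  qed
  obtain k1 :: nat where k1: "real k1 * d \<ge> ln 16" using reals_Archimedean3[OF d] less_imp_le by metis
  define k where "k = max k0 k1"
  define B where "B = exp (real k * d)"
  have "real k1 * d \<le> real k * d" using d by (intro mult_right_mono) (auto simp: k_def)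
  then have "ln 16 \<le> real k * d" using k1 by linarith
  then have B16: "B \<ge> 16" unfolding B_def by (metis exp_le_cancel_iff exp_ln zero_less_numeral)
  \<comment> \<open>The 5 makes \<open>\<kappa> * L T \<le> L s / 5\<close>. With an arc term of at
    most \<open>L s / 4\<close>, the right-hand side of the half-plane bound stays below
    \<open>L s / 2\<close>, a contradiction.\<close>
  define \<kappa> where "\<kappa> = 1 / (5 * D2 ^ k)"
  have \<kappa>: "\<kappa> > 0" using D2 by (simp add: \<kappa>_def)
  have "\<forall>\<^sub>F T in at_top. L (T + ln 6) \<ge> 2 - 2 * ln c"
  proof -
    have "filterlim (\<lambda>T::real. T + ln 6) at_top at_top" by real_asymp
    from filterlim_compose[OF L_at_top this] show ?thesis
      unfolding filterlim_at_top by blast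
  qed
  then obtain T1 where T1: "\<And>T. T \<ge> T1 \<Longrightarrow> L (T + ln 6) \<ge> 2 - 2 * ln c"
    unfolding eventually_at_top_linorder by blast
  define T0 where "T0 = Max {T1, 2 * real k * d, ln M1 + real k * d, 0}"
  show ?thesis
  proof (rule that[OF \<kappa>, of T0])
    fix T assume "T \<ge> T0"
    then have T: "T \<ge> T1" "T \<ge> 2 * real k * d" "T \<ge> ln M1 + real k * d" "T \<ge> 0"
      by (auto simp: T0_def)
    define s where "s = T - real k * d"
    have s: "s \<ge> ln M1" "T / 2 \<le> s" using T by (auto simp: s_def)
    define R where "R = exp s"
    have BR: "B * R = exp T" by (simp add: B_def R_def s_def exp_add[symmetric])
    \<comment> \<open>Twice \<open>exp T\<close>, so that the two-sided estimate, valid up to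
      \<open>R1 / 2\<close>, reaches all radii up to \<open>B * R\<close>.\<close>
    define R1 where "R1 = 2 * exp T"
    have "exp T \<ge> 1" using T by simp
    then have R1: "R1 \<ge> 1" unfolding R1_def by linarith
    define E where "E = 4 * (ln (max_modulus (3 * R1) f) + 1 - ln c) / R1"
    from dec[OF R1 E_def] obtain bs where E0: "E \<ge> 0" and bs: "\<forall>b\<in>set bs. 0 < b \<and> b \<le> R1"
      and out: "\<And>\<rho>. \<rho> \<ge> 3*R1 \<Longrightarrow> c * \<rho>^p * (\<Prod>b\<leftarrow>bs. \<rho> / b - 1) \<le> max_modulus \<rho> f"
      and lohi: "\<And>z. norm z \<le> R1 / 2 \<Longrightarrow>
          c * norm z ^ p * (\<Prod>b\<leftarrow>bs. \<bar>1 - norm z / b\<bar>) * exp (- E * norm z) \<le> norm (f z) \<and>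
          norm (f z) \<le> c * norm z ^ p * (\<Prod>b\<leftarrow>bs. 1 + norm z / b) * exp (E * norm z)"
      unfolding zero_split_def by blast
    have M6: "max_modulus (3 * R1) f = exp (L (T + ln 6))"
      using max_modulus_exp[of "T + ln 6"] by (simp add: R1_def exp_add mult.commute)
    define G where "G r = c * r ^ p * (\<Prod>b\<leftarrow>bs. 1 + r / b) * exp (E * r)" for r
    have GR: "exp (L s) \<le> G R"
    proof -
      obtain z where z: "norm z = R" "norm (f z) = max_modulus R f"
        using max_modulus_attained[OF holo, of R] by (auto simp: R_def)
      have "R \<le> R1 / 2" using d T by (simp add: R_def R1_def s_def)
      then have "norm (f z) \<le> G R" using lohi[of z] z by (simp add: G_def)
      then show ?thesis using z max_modulus_exp[of s] by (simp add: R_def)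
    qed
    have Ls: "L s > 0" by (rule L_pos[OF s(1)])
    have G1: "G R \<ge> 1" using GR Ls by (meson one_le_exp_iff less_imp_le order_trans)
    have LT6: "L (T + ln 6) \<le> D2 ^ (j + k) * L s"
    proof -
      have "L (T + ln 6) \<le> L (s + real (j + k) * ln D1)"
        using j by (intro L_mono) (simp add: s_def d_def algebra_simps)
      also have "\<dots> \<le> D2 ^ (j + k) * L s" by (rule L_shift_iter[OF s(1)])
      finally show ?thesis .
    qed
    \<comment> \<open>Each factor \<open>1 + exp T / b\<close> is at most
      \<open>3 * R1 / b - 1\<close>, so one copy of \<open>L (T + ln 6)\<close> bounds the product.
      The exponent \<open>E * exp T\<close> contributes two more and a constant, which
      \<open>T1\<close> absorbs into a fourth.\<close>
    have GB: "ln (G (B * R)) \<le> 4 * L (T + ln 6)"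
    proof -
      have e3: "3 * R1 = 6 * exp T" by (simp add: R1_def)
      have t: "0 \<le> 1 + exp T / b \<and> 1 + exp T / b \<le> 3 * R1 / b - 1" if "b \<in> set bs" for b
        using bs that exp_gt_zero[of T] by (auto simp: R1_def field_simps)
      have pr: "(\<Prod>b\<leftarrow>bs. 1 + exp T / b) \<le> (\<Prod>b\<leftarrow>bs. 3 * R1 / b - 1)"
        "0 \<le> (\<Prod>b\<leftarrow>bs. 1 + exp T / b)"
        using prod_list_mono_nonneg[of bs "\<lambda>b. 1 + exp T / b" "\<lambda>b. 3 * R1 / b - 1"] t by auto
      have "c * exp T ^ p * (\<Prod>b\<leftarrow>bs. 1 + exp T / b) \<le> c * (3 * R1) ^ p * (\<Prod>b\<leftarrow>bs. 3 * R1 / b - 1)"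
        using c pr by (intro mult_mono power_mono mult_nonneg_nonneg) (auto simp: R1_def)
      also have "\<dots> \<le> exp (L (T + ln 6))" using out[of "3 * R1"] R1 by (simp add: M6)
      finally have "G (exp T) \<le> exp (L (T + ln 6)) * exp (E * exp T)"
        unfolding G_def by (intro mult_right_mono) auto
      moreover have "E * exp T = 2 * (L (T + ln 6) + 1 - ln c)"
        unfolding E_def M6 by (simp add: R1_def)
      ultimately have "G (exp T) \<le> exp (L (T + ln 6) + 2 * (L (T + ln 6) + 1 - ln c))"
        by (simp only: exp_add[symmetric])
      moreover have "G (exp T) > 0"
      proof -
        have "(\<Prod>b\<leftarrow>bs. 1) \<le> (\<Prod>b\<leftarrow>bs. 1 + exp T / b)"
          by (rule prod_list_mono_nonneg(2)) (use bs in \<open>force simp: less_imp_le\<close>)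
        then have "0 < (\<Prod>b\<leftarrow>bs. 1 + exp T / b)" by (simp add: map_replicate_const prod_list_replicate)
        then show ?thesis unfolding G_def using c by simp
      qed
      ultimately have "ln (G (exp T)) \<le> L (T + ln 6) + 2 * (L (T + ln 6) + 1 - ln c)"
        by (metis ln_exp ln_mono)
      moreover have "x + 2 * (x + 1 - y) \<le> 4 * x" if "2 - 2 * y \<le> x" for x y :: real
        using that by simp
      ultimately show ?thesis using T1[OF T(1)] unfolding BR by (meson order_trans)
    qed
    have "\<exists>t. s \<le> t \<and> t \<le> T \<and> (\<forall>z. norm z = exp t \<longrightarrow> exp (\<kappa> * L T) \<le> norm (f z))"
    proof (rule ccontr)
      assume neg: "\<not> ?thesis"
      have LT: "L T \<le> D2 ^ k * L s" using L_shift_iter[OF s(1), of k] by (simp add: s_def d_def)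
      have LT0: "L T \<ge> 0" using Ls L_mono[of s T] d by (simp add: s_def)
      \<comment> \<open>If no circle works, every circle of radius \<open>r\<close> between
        \<open>R\<close> and \<open>B * R\<close> has a point with
        \<open>norm (f z) < exp (\<kappa> * L T)\<close>; the lower estimate at that point yields
        the smallness hypothesis of \<open>half_plane_bound\<close>.\<close>
      have small: "c * r ^ p * (\<Prod>b\<leftarrow>bs. \<bar>1 - r / b\<bar>) * exp (- E * r) \<le> exp (\<kappa> * L T)"
        if r: "R \<le> r" "r \<le> B * R" for r
      proof -
        have r0: "r > 0" using r(1) exp_gt_zero[of s] unfolding R_def by linarith
        have "exp s \<le> exp (ln r)" "exp (ln r) \<le> exp T" using r r0 unfolding BR by (auto simp: R_def)
        then have "s \<le> ln r" "ln r \<le> T" by (simp_all only: exp_le_cancel_iff)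
        then obtain z where z: "norm z = exp (ln r)" "\<not> exp (\<kappa> * L T) \<le> norm (f z)"
          using neg by blast
        then have zr: "norm z = r" using r0 by simp
        have "r \<le> R1 / 2" using r(2) unfolding BR by (simp add: R1_def)
        then show ?thesis using lohi[of z] z(2) unfolding zr by linarith
      qed
      have hp: "ln (G R) / 2 \<le> \<kappa> * L T + ln (G (B * R)) * ((4 / sqrt B) powr \<gamma> / cs)"
        unfolding G_def cs_def
        by (rule half_plane_bound[OF c E0 _ \<gamma>(1,2) _ B16 _ _ small])
           (use bs G1 \<kappa> LT0 in \<open>auto simp: R_def G_def\<close>)
      have "(4 / sqrt B) powr \<gamma> = 4 powr \<gamma> * exp (- \<gamma> * d / 2) ^ k"
      proof -
        have "sqrt B = exp (real k * d / 2)"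
          unfolding B_def by (rule real_sqrt_unique) (auto simp: exp_of_nat_mult[symmetric] power2_eq_square exp_add[symmetric])
        then have "(4 / sqrt B) powr \<gamma> = 4 powr \<gamma> / exp (real k * d / 2) powr \<gamma>" by (simp add: powr_divide)
        also have "exp (real k * d / 2) powr \<gamma> = exp (\<gamma> * (real k * d / 2))"
          by (metis exp_powr_real mult.commute)
        also have "4 powr \<gamma> / \<dots> = 4 powr \<gamma> * exp (real k * (- \<gamma> * d / 2))"
        proof -
          have "real k * (- \<gamma> * d / 2) = - (\<gamma> * (real k * d / 2))" by simp
          then show ?thesis by (simp only: exp_minus divide_inverse)
        qed
        finally show ?thesis by (simp only: exp_of_nat_mult)
      qed
      moreover have "ln (G (B * R)) * ((4 / sqrt B) powr \<gamma> / cs)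
          \<le> (4 * (D2 ^ (j + k) * L s)) * ((4 / sqrt B) powr \<gamma> / cs)"
        using GB LT6 cs by (intro mult_right_mono) auto
      ultimately have "ln (G (B * R)) * ((4 / sqrt B) powr \<gamma> / cs) \<le> C * q ^ k * L s"
        by (simp add: C_def q_def power_add power_mult_distrib mult_ac)
      also have "C * q ^ k * L s \<le> (1 / 4) * L s"
      proof -
        have "q ^ k < 1 / (4 * C)" by (rule k0) (simp add: k_def)
        then have "C * q ^ k \<le> 1 / 4" using C by (simp add: field_simps)
        then show ?thesis using Ls by (intro mult_right_mono) auto
      qed
      finally have "ln (G (B * R)) * ((4 / sqrt B) powr \<gamma> / cs) \<le> L s / 4" by simp
      moreover have "\<kappa> * L T \<le> L s / 5"
      proof -
        have "\<kappa> * L T \<le> \<kappa> * (D2 ^ k * L s)" using LT \<kappa> by (intro mult_left_mono) auto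
        also have "\<dots> = L s / 5" using D2 by (simp add: \<kappa>_def)
        finally show ?thesis .
      qed
      moreover have "L s \<le> ln (G R)" using GR G1 by (metis exp_gt_zero ln_exp ln_mono)
      ultimately show False using hp Ls by linarith
    qed
    then show "\<exists>t. T / 2 \<le> t \<and> t \<le> T \<and> (\<forall>z. norm z = exp t \<longrightarrow> exp (\<kappa> * L T) \<le> norm (f z))"
      using s(2) order_trans by blast
  qed
qed

end

text \<open>Compares the lower product with the upper one in multiplied-out form, since
  \<open>\<bar>r - b\<bar>\<close> and \<open>\<bar>1 - r / b\<bar>\<close> may be zero.\<close>

lemma prod_list_divide_swap:
  fixes r :: real
  assumes "\<And>b. b \<in> set bs \<Longrightarrow> b > 0"
  shows "(\<Prod>b\<leftarrow>bs. \<bar>1 - r / b\<bar>) * (\<Prod>b\<leftarrow>bs. r + b) = (\<Prod>b\<leftarrow>bs. 1 + r / b) * (\<Prod>b\<leftarrow>bs. \<bar>r - b\<bar>)"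
  using assms
proof (induction bs)
  case (Cons b bs)
  have b: "b > 0" using Cons.prems by simp
  have "\<bar>1 - r / b\<bar> = \<bar>r - b\<bar> / b"
  proof -
    have "1 - r / b = (b - r) / b" using b by (simp add: diff_divide_distrib)
    then show ?thesis using b by (simp add: abs_divide abs_minus_commute)
  qed
  moreover have "1 + r / b = (r + b) / b" using b by (simp add: add_divide_distrib)
  ultimately have "\<bar>1 - r / b\<bar> * (r + b) = (1 + r / b) * \<bar>r - b\<bar>" by simp
  moreover have "(\<Prod>b\<leftarrow>bs. \<bar>1 - r / b\<bar>) * (\<Prod>b\<leftarrow>bs. r + b) = (\<Prod>b\<leftarrow>bs. 1 + r / b) * (\<Prod>b\<leftarrow>bs. \<bar>r - b\<bar>)"
    using Cons by simp
  ultimately have "(\<bar>1 - r / b\<bar> * (r + b)) * ((\<Prod>b\<leftarrow>bs. \<bar>1 - r / b\<bar>) * (\<Prod>b\<leftarrow>bs. r + b))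
     = ((1 + r / b) * \<bar>r - b\<bar>) * ((\<Prod>b\<leftarrow>bs. 1 + r / b) * (\<Prod>b\<leftarrow>bs. \<bar>r - b\<bar>))" by (simp only:)
  then show ?case by (simp only: list.map prod_list.Cons mult_ac)
qed simp

context regular_growth
begin

text \<open>The discs of radii \<open>exp T\<close> and \<open>exp (T - T powr (3/4))\<close> are far enough apart to
  bound the number of zeros in the smaller one by \<open>o(L T)\<close>.\<close>
lemma minimum_modulus_sharp:
  obtains T0 where
    "\<And>T. T \<ge> T0 \<Longrightarrow> \<exists>t. T - T powr (3/4) - ln (2 * T) \<le> t \<and> t \<le> T \<and>
      (\<forall>z. norm z = exp t \<longrightarrow> exp (L (T - T powr (3/4) - ln (2 * T))
          - L T * (4 * ln (16 * exp 1 * T) / T powr (3/4) + 16 / T)) \<le> norm (f z))"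
proof -
  obtain z1 where z1: "f z1 \<noteq> 0" by (rule nonzero)
  obtain p :: nat and c :: real where c: "c > 0" and dec:
    "\<And>R E. R \<ge> 1 \<Longrightarrow> E = 4 * (ln (max_modulus (3 * R) f) + 1 - ln c) / R \<Longrightarrow>
      E \<ge> 0 \<and> (\<exists>bs. zero_split f p c R E bs)"
    by (rule zero_decomposition[OF holo z1]) (rule that)
  have "\<forall>\<^sub>F T::real in at_top. T \<ge> 2 \<and> T powr (3/4) \<ge> 2 \<and> T powr (3/4) \<ge> ln 3 \<and> T \<ge> T powr (3/4)"
    by (intro eventually_conj; real_asymp)
  moreover have "\<forall>\<^sub>F T in at_top. L T \<ge> 1 - ln c"
    using L_at_top unfolding filterlim_at_top by blast
  ultimately have "\<forall>\<^sub>F T in at_top. (T \<ge> 2 \<and> T powr (3/4) \<ge> 2 \<and> T powr (3/4) \<ge> ln 3 \<and> T \<ge> T powr (3/4))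
      \<and> L T \<ge> 1 - ln c" by (rule eventually_conj)
  then obtain T0 where T0: "\<And>T. T \<ge> T0 \<Longrightarrow> (T \<ge> 2 \<and> T powr (3/4) \<ge> 2 \<and> T powr (3/4) \<ge> ln 3 \<and> T \<ge> T powr (3/4))
      \<and> L T \<ge> 1 - ln c" unfolding eventually_at_top_linorder by blast
  show ?thesis
  proof (rule that[of T0])
    fix T assume "T \<ge> T0"
    define u where "u = T powr (3/4)"
    have T: "T \<ge> 2" "u \<ge> 2" "u \<ge> ln 3" "T \<ge> u" "L T \<ge> 1 - ln c" using T0[OF \<open>T \<ge> T0\<close>] by (auto simp: u_def)
    define R where "R = exp (T - u)"
    have R: "R \<ge> 1" using T by (simp add: R_def)
    define E where "E = 4 * (ln (max_modulus (3 * R) f) + 1 - ln c) / R"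
    from dec[OF R E_def] obtain bs where E0: "E \<ge> 0" and bs: "\<forall>b\<in>set bs. 0 < b \<and> b \<le> R"
      and out: "\<And>\<rho>. \<rho> \<ge> 3*R \<Longrightarrow> c * \<rho>^p * (\<Prod>b\<leftarrow>bs. \<rho> / b - 1) \<le> max_modulus \<rho> f"
      and lohi: "\<And>z. norm z \<le> R / 2 \<Longrightarrow>
          c * norm z ^ p * (\<Prod>b\<leftarrow>bs. \<bar>1 - norm z / b\<bar>) * exp (- E * norm z) \<le> norm (f z) \<and>
          norm (f z) \<le> c * norm z ^ p * (\<Prod>b\<leftarrow>bs. 1 + norm z / b) * exp (E * norm z)"
      unfolding zero_split_def by blast
    define n where "n = length bs"
    have R3: "3 * R = exp (T - u + ln 3)" by (simp add: R_def exp_add)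
    then have R3T: "3 * R \<le> exp T" using T by simp
    have E_le: "E \<le> 8 * L T / R"
    proof -
      have "ln (max_modulus (3 * R) f) \<le> L T" unfolding R3 max_modulus_exp ln_exp using T by (intro L_mono) simp
      moreover have "4 * (x + 1 - y) \<le> 8 * l" if "x \<le> l" "1 - y \<le> l" for x y l :: real
        using that by simp
      ultimately have "4 * (ln (max_modulus (3 * R) f) + 1 - ln c) \<le> 8 * L T" using T(5) by blast
      then show ?thesis unfolding E_def using R by (intro divide_right_mono) auto
    qed
    \<comment> \<open>Each zero in the disc of radius \<open>R\<close> contributes at least
      \<open>exp (u / 2)\<close> to a product bounded through \<open>max_modulus (exp T) f\<close>;
      comparing logarithms counts the zeros.\<close>
    have n_le: "real n \<le> 4 * L T / u"
    proof -
      have x: "exp (u / 2) \<le> exp u - 1"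
      proof -
        define x where "x = exp (u / 2)"
        have "x \<ge> 1 + u / 2" unfolding x_def by (rule exp_ge_add_one_self)
        then have x2: "x \<ge> 2" using T by linarith
        then have "2 * x \<le> x * x" by (intro mult_right_mono) auto
        moreover have "x * x = exp u" by (simp add: x_def exp_add[symmetric])
        ultimately show ?thesis using x2 unfolding x_def[symmetric] by linarith
      qed
      have "(\<Prod>b\<leftarrow>bs. exp (u / 2)) \<le> (\<Prod>b\<leftarrow>bs. exp T / b - 1)"
      proof (rule prod_list_mono_nonneg(2))
        fix b assume b: "b \<in> set bs"
        have "exp u = exp T / R" by (simp add: R_def exp_diff)
        also have "\<dots> \<le> exp T / b" using bs b R by (intro divide_left_mono) auto
        finally show "0 \<le> exp (u / 2) \<and> exp (u / 2) \<le> exp T / b - 1" using x by auto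
      qed
      then have pr: "exp (u / 2) ^ n \<le> (\<Prod>b\<leftarrow>bs. exp T / b - 1)"
        by (simp add: map_replicate_const prod_list_replicate n_def)
      have "c * 1 * exp (u / 2) ^ n \<le> c * exp T ^ p * (\<Prod>b\<leftarrow>bs. exp T / b - 1)"
        using c pr T by (intro mult_mono one_le_power) auto
      also have "\<dots> \<le> exp (L T)" using out[OF R3T] by (simp add: max_modulus_exp)
      also have "c * 1 * exp (u / 2) ^ n = exp (ln c + real n * (u / 2))"
        using c by (simp only: exp_add exp_of_nat_mult exp_ln mult_1_right)
      finally have "exp (ln c + real n * (u / 2)) \<le> exp (L T)" .
      then have "ln c + real n * (u / 2) \<le> L T" by simp
      moreover have "real n * u \<le> 4 * l" if "y + real n * (u / 2) \<le> l" "1 - y \<le> l" for y l :: real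
        using that by simp
      ultimately have "real n * u \<le> 4 * L T" using T(5) by blast
      then show ?thesis using T by (simp add: field_simps)
    qed
    \<comment> \<open>Dividing by \<open>T\<close> makes the error \<open>E * r\<close> at most
      \<open>8 * L T / T\<close> and lowers the logarithmic scale by only
      \<open>ln T\<close>.\<close>
    define \<rho> where "\<rho> = R / T"
    have rho: "\<rho> > 0" "\<rho> \<le> R / 2" using R T by (auto simp: \<rho>_def field_simps)
    obtain r where r: "\<rho> / 2 \<le> r" "r \<le> \<rho>" and rp: "((\<rho> - \<rho> / 2) / (4 * exp 1)) ^ n \<le> (\<Prod>\<beta>\<leftarrow>bs. \<bar>r - \<beta>\<bar>)"
      using exists_large_product[of "\<rho> / 2" \<rho> bs] rho unfolding n_def by auto
    have r0: "r > 0" using r rho by linarith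
    \<comment> \<open>The quotient of \<open>2 * R\<close>, an upper bound for \<open>r + b\<close>,
      by \<open>\<rho> / (8 * exp 1)\<close>, the lower bound for \<open>\<bar>r - b\<bar>\<close>
      per zero in geometric mean.\<close>
    define K where "K = 16 * exp 1 * T"
    have K: "K \<ge> 1"
    proof -
      have "16 * exp 1 * T \<ge> 1 * 1 * 1" using T by (intro mult_mono) auto
      then show ?thesis by (simp add: K_def)
    qed
    have frac: "(\<Prod>b\<leftarrow>bs. 1 + r / b) \<le> (\<Prod>b\<leftarrow>bs. \<bar>1 - r / b\<bar>) * K ^ n"
    proof -
      define A1 where "A1 = (\<Prod>b\<leftarrow>bs. \<bar>1 - r / b\<bar>)"
      define A2 where "A2 = (\<Prod>b\<leftarrow>bs. 1 + r / b)"
      have A1: "A1 \<ge> 0" unfolding A1_def by (rule prod_list_mono_nonneg(1)[where g="\<lambda>b. \<bar>1 - r / b\<bar>"]) auto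
      have A2: "A2 \<ge> 0" unfolding A2_def by (rule prod_list_mono_nonneg(1)[where g="\<lambda>b. 1 + r / b"]) (use bs r0 in \<open>auto simp: less_imp_le\<close>)
      have "(\<Prod>b\<leftarrow>bs. r + b) \<le> (\<Prod>b\<leftarrow>bs. 2 * R)"
        by (rule prod_list_mono_nonneg(2)) (use bs r r0 rho R in force)
      then have s: "(\<Prod>b\<leftarrow>bs. r + b) \<le> (2 * R) ^ n" by (simp add: map_replicate_const prod_list_replicate n_def)
      have "A2 * (\<rho> / (8 * exp 1)) ^ n \<le> A2 * (\<Prod>\<beta>\<leftarrow>bs. \<bar>r - \<beta>\<bar>)"
        using rp A2 by (intro mult_left_mono) auto
      also have "\<dots> = A1 * (\<Prod>b\<leftarrow>bs. r + b)"
        using prod_list_divide_swap[of bs r] bs by (simp add: A1_def A2_def)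
      also have "\<dots> \<le> A1 * (2 * R) ^ n" using s A1 by (intro mult_left_mono)
      finally have *: "A2 * (\<rho> / (8 * exp 1)) ^ n \<le> A1 * (2 * R) ^ n" .
      have "2 * R = K * (\<rho> / (8 * exp 1))" using T by (simp add: K_def \<rho>_def)
      then have "(2 * R) ^ n = K ^ n * (\<rho> / (8 * exp 1)) ^ n" by (metis power_mult_distrib)
      then have "A2 * (\<rho> / (8 * exp 1)) ^ n \<le> (A1 * K ^ n) * (\<rho> / (8 * exp 1)) ^ n" using * by (simp only: mult.assoc)
      then show ?thesis unfolding A1_def[symmetric] A2_def[symmetric]
        by (rule mult_right_le_imp_le) (use rho in simp)
    qed
    define t where "t = ln r"
    define T1 where "T1 = T - u - ln (2 * T)"
    have "T1 = ln (\<rho> / 2)" using T by (simp add: T1_def \<rho>_def R_def ln_div ln_mult)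
    moreover have "ln (\<rho> / 2) \<le> ln r" using r rho by (intro ln_mono) auto
    ultimately have t1: "T1 \<le> t" by (simp add: t_def)
    have "r \<le> exp T" using r rho R3T R by linarith
    then have t2: "t \<le> T" using r0 by (simp add: t_def) (metis exp_ln ln_exp ln_mono)
    define \<epsilon> where "\<epsilon> = 4 * ln K / u + 16 / T"
    have lower: "exp (L T1 - L T * \<epsilon>) \<le> norm (f z)" if z: "norm z = exp t" for z
    proof -
      have zr: "norm z = r" using z r0 by (simp add: t_def)
      have rR: "r \<le> R / 2" using r rho by linarith
      \<comment> \<open>All points of the circle share the same products, so \<open>f z\<close> can
        be compared with the value at a maximum point \<open>w\<close>; the loss is
        \<open>K ^ n * exp (2 * E * r)\<close>.\<close>
      obtain w where w: "norm w = r" "norm (f w) = max_modulus r f"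
        using max_modulus_attained[OF holo, of r] r0 by (metis less_imp_le)
      have M: "max_modulus r f = exp (L t)" using max_modulus_L[OF r0] by (simp add: t_def)
      have crp: "c * r ^ p \<ge> 0" using c r0 by simp
      have "exp (L t) \<le> c * r ^ p * (\<Prod>b\<leftarrow>bs. 1 + r / b) * exp (E * r)"
        using lohi[of w] w rR M by simp
      also have "\<dots> \<le> c * r ^ p * ((\<Prod>b\<leftarrow>bs. \<bar>1 - r / b\<bar>) * K ^ n) * exp (E * r)"
        using frac crp by (intro mult_right_mono mult_left_mono) auto
      also have "\<dots> = (c * r ^ p * (\<Prod>b\<leftarrow>bs. \<bar>1 - r / b\<bar>) * exp (- E * r)) * (K ^ n * exp (2 * E * r))"
      proof -
        have "exp (E * r) = exp (- E * r) * exp (2 * E * r)" by (simp add: exp_add[symmetric])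
        then show ?thesis by (simp only: mult_ac)
      qed
      also have "\<dots> \<le> norm (f z) * (K ^ n * exp (2 * E * r))"
        using lohi[of z] zr rR K by (intro mult_right_mono) auto
      also have "K ^ n = exp (real n * ln K)" using K by (simp add: exp_of_nat_mult)
      also have "norm (f z) * (exp (real n * ln K) * exp (2 * E * r)) = norm (f z) * exp (real n * ln K + 2 * E * r)"
        by (simp only: exp_add)
      finally have 1: "exp (L t) \<le> norm (f z) * exp (real n * ln K + 2 * E * r)" .
      have "real n * ln K + 2 * E * r \<le> L T * \<epsilon>"
      proof -
        have "real n * ln K \<le> 4 * L T / u * ln K" using n_le K by (intro mult_right_mono) auto
        moreover have "2 * E * r \<le> 2 * (8 * L T / R) * \<rho>"
          using E_le E0 r r0 by (intro mult_mono) auto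
        moreover have "2 * (8 * L T / R) * \<rho> = L T * (16 / T)" using R by (simp add: \<rho>_def)
        moreover have "4 * L T / u * ln K = L T * (4 * ln K / u)" by simp
        ultimately show ?thesis unfolding \<epsilon>_def distrib_left by linarith
      qed
      then have "norm (f z) * exp (real n * ln K + 2 * E * r) \<le> norm (f z) * exp (L T * \<epsilon>)"
        by (intro mult_left_mono) auto
      then have "exp (L t) \<le> norm (f z) * exp (L T * \<epsilon>)" using 1 by (rule order_trans[rotated])
      moreover have "exp (L T1) \<le> exp (L t)" using L_mono[OF t1] by simp
      ultimately have "exp (L T1) \<le> norm (f z) * exp (L T * \<epsilon>)" by (rule order_trans[rotated])
      then show ?thesis by (simp add: exp_diff divide_le_eq)
    qed
    show "\<exists>t. T - T powr (3/4) - ln (2 * T) \<le> t \<and> t \<le> T \<and>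
      (\<forall>z. norm z = exp t \<longrightarrow> exp (L (T - T powr (3/4) - ln (2 * T))
          - L T * (4 * ln (16 * exp 1 * T) / T powr (3/4) + 16 / T)) \<le> norm (f z))"
      using t1 t2 lower unfolding T1_def u_def \<epsilon>_def K_def by blast
  qed
qed

text \<open>Between the two scales \<open>T\<close> and \<open>T - T powr (3/4) - ln (2 * T)\<close> either \<open>L\<close> grows little, and
  the sharp estimate loses only a factor close to 1, or it grows by \<open>T powr (1/4)\<close>, which makes up for
  the constant \<open>\<kappa>\<close> of the crude one.\<close>
lemma minimum_modulus_convex:
  obtains T0 where
    "\<And>T t. T \<ge> T0 \<Longrightarrow> 1 \<le> t \<Longrightarrow> t \<le> T / 2 \<Longrightarrow> \<bar>L 0\<bar> \<le> L t \<Longrightarrow>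
      \<exists>s. T / 2 \<le> s \<and> s \<le> T \<and>
        (\<forall>z. norm z = exp s \<longrightarrow> exp ((1 - T powr (-1/8)) * ((T / t) * (L t - \<bar>L 0\<bar>))) \<le> norm (f z))"
proof -
  obtain \<kappa> Ta where \<kappa>: "\<kappa> > 0" and crude:
    "\<And>T. T \<ge> Ta \<Longrightarrow> \<exists>t. T / 2 \<le> t \<and> t \<le> T \<and> (\<forall>z. norm z = exp t \<longrightarrow> exp (\<kappa> * L T) \<le> norm (f z))"
    by (rule minimum_modulus_power) (rule that)
  obtain Tb where sharp: "\<And>T. T \<ge> Tb \<Longrightarrow> \<exists>t. T - T powr (3/4) - ln (2 * T) \<le> t \<and> t \<le> T \<and>
      (\<forall>z. norm z = exp t \<longrightarrow> exp (L (T - T powr (3/4) - ln (2 * T))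
          - L T * (4 * ln (16 * exp 1 * T) / T powr (3/4) + 16 / T)) \<le> norm (f z))"
    by (rule minimum_modulus_sharp) (rule that)
  define T1 where "T1 T = T - T powr (3/4) - ln (2 * T)" for T :: real
  define \<epsilon> where "\<epsilon> T = 4 * ln (16 * exp 1 * T) / T powr (3/4) + 16 / T" for T :: real
  have e1: "\<forall>\<^sub>F T in at_top. T \<ge> 2 \<and> \<epsilon> T \<ge> 0 \<and> T1 T \<ge> T / 2"
    unfolding T1_def \<epsilon>_def by (intro eventually_conj; real_asymp)
  have e2: "\<forall>\<^sub>F T in at_top. T powr (1/4) * \<epsilon> T \<le> 1"
    unfolding \<epsilon>_def by real_asymp
  \<comment> \<open>Here \<open>T powr (1/4) * \<epsilon> T\<close> has order
    \<open>T powr (-1/2) * ln T\<close> and \<open>1 - T1 T / T\<close> has order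
    \<open>T powr (-1/4)\<close>; both are dominated by \<open>T powr (-1/8)\<close>.\<close>
  have e3: "\<forall>\<^sub>F T in at_top. 1 - T powr (-1/8) \<le> (1 - T powr (1/4) * \<epsilon> T) * (T1 T / T)"
    unfolding T1_def \<epsilon>_def by real_asymp
  have "filterlim (\<lambda>T. T powr (1/4) * (T1 T / T)) at_top at_top"
    unfolding T1_def by real_asymp
  then have e4: "\<forall>\<^sub>F T in at_top. 1 / \<kappa> \<le> T powr (1/4) * (T1 T / T)"
    unfolding filterlim_at_top by blast
  have "\<forall>\<^sub>F T in at_top. (T \<ge> 2 \<and> \<epsilon> T \<ge> 0 \<and> T1 T \<ge> T / 2) \<and> T powr (1/4) * \<epsilon> T \<le> 1 \<and>
     1 - T powr (-1/8) \<le> (1 - T powr (1/4) * \<epsilon> T) * (T1 T / T) \<and> 1 / \<kappa> \<le> T powr (1/4) * (T1 T / T)"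
    by (intro eventually_conj e1 e2 e3 e4)
  then obtain Tc where Tc: "\<And>T. T \<ge> Tc \<Longrightarrow> (T \<ge> 2 \<and> \<epsilon> T \<ge> 0 \<and> T1 T \<ge> T / 2) \<and> T powr (1/4) * \<epsilon> T \<le> 1 \<and>
     1 - T powr (-1/8) \<le> (1 - T powr (1/4) * \<epsilon> T) * (T1 T / T) \<and> 1 / \<kappa> \<le> T powr (1/4) * (T1 T / T)"
    unfolding eventually_at_top_linorder by blast
  show ?thesis
  proof (rule that[of "max Ta (max Tb Tc)"])
    fix T t assume "T \<ge> max Ta (max Tb Tc)" and t: "1 \<le> t" "t \<le> T / 2" "\<bar>L 0\<bar> \<le> L t"
    then have Ts: "T \<ge> Ta" "T \<ge> Tb" "T \<ge> Tc" by auto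
    have T: "T \<ge> 2" "\<epsilon> T \<ge> 0" "T1 T \<ge> T / 2" "T powr (1/4) * \<epsilon> T \<le> 1"
     "1 - T powr (-1/8) \<le> (1 - T powr (1/4) * \<epsilon> T) * (T1 T / T)" "1 / \<kappa> \<le> T powr (1/4) * (T1 T / T)"
      using Tc[OF Ts(3)] by auto
    define X where "X = (T / t) * (L t - \<bar>L 0\<bar>)"
    have X: "X \<ge> 0" using t T by (simp add: X_def)
    have "L (T1 T) \<ge> (T1 T / t) * (L t - \<bar>L 0\<bar>)" using t T by (intro L_ge_linear) auto
    also have "(T1 T / t) * (L t - \<bar>L 0\<bar>) = (T1 T / T) * X" using T by (simp add: X_def)
    finally have LX: "(T1 T / T) * X \<le> L (T1 T)" .
    have L0: "L (T1 T) \<ge> 0"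
    proof -
      have "0 \<le> (T1 T / T) * X" using X T by (intro mult_nonneg_nonneg divide_nonneg_nonneg) auto
      then show ?thesis using LX by linarith
    qed
    define \<eta> where "\<eta> = T powr (-1/8)"
    have "\<exists>s. T / 2 \<le> s \<and> s \<le> T \<and> (\<forall>z. norm z = exp s \<longrightarrow> exp ((1 - \<eta>) * X) \<le> norm (f z))"
    proof (cases "L T \<le> T powr (1/4) * L (T1 T)")
      case True
      have "(1 - \<eta>) * X \<le> ((1 - T powr (1/4) * \<epsilon> T) * (T1 T / T)) * X"
        using T(5) X unfolding \<eta>_def by (intro mult_right_mono)
      also have "\<dots> = (1 - T powr (1/4) * \<epsilon> T) * ((T1 T / T) * X)" by (simp only: mult.assoc)
      also have "\<dots> \<le> (1 - T powr (1/4) * \<epsilon> T) * L (T1 T)" using LX T(4) by (intro mult_left_mono) auto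
      also have "\<dots> = L (T1 T) - (T powr (1/4) * L (T1 T)) * \<epsilon> T" by (simp add: algebra_simps)
      also have "\<dots> \<le> L (T1 T) - L T * \<epsilon> T" using mult_right_mono[OF True T(2)] by linarith
      finally have le: "exp ((1 - \<eta>) * X) \<le> exp (L (T1 T) - L T * \<epsilon> T)" by simp
      obtain s where "T1 T \<le> s" "s \<le> T" "\<And>z. norm z = exp s \<Longrightarrow> exp (L (T1 T) - L T * \<epsilon> T) \<le> norm (f z)"
        using sharp[OF Ts(2)] unfolding T1_def \<epsilon>_def by blast
      then show ?thesis using T(3) le by (meson order_trans)
    next
      case False
      have "(1 - \<eta>) * X \<le> 1 * X" using X by (intro mult_right_mono) (auto simp: \<eta>_def)
      also have "1 * X \<le> (\<kappa> * (T powr (1/4) * (T1 T / T))) * X"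
        using X T(6) \<kappa> by (intro mult_right_mono) (auto simp: field_simps)
      also have "\<dots> = (\<kappa> * T powr (1/4)) * ((T1 T / T) * X)" by (simp only: mult.assoc)
      also have "\<dots> \<le> (\<kappa> * T powr (1/4)) * L (T1 T)" using LX \<kappa> by (intro mult_left_mono) auto
      also have "\<dots> = \<kappa> * (T powr (1/4) * L (T1 T))" by (simp only: mult.assoc)
      also have "\<dots> \<le> \<kappa> * L T" using False \<kappa> by (intro mult_left_mono) auto
      finally have le: "exp ((1 - \<eta>) * X) \<le> exp (\<kappa> * L T)" by simp
      obtain s where "T / 2 \<le> s" "s \<le> T" "\<And>z. norm z = exp s \<Longrightarrow> exp (\<kappa> * L T) \<le> norm (f z)"
        using crude[OF Ts(1)] by blast
      then show ?thesis using le by (meson order_trans)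
    qed
    then show "\<exists>s. T / 2 \<le> s \<and> s \<le> T \<and>
        (\<forall>z. norm z = exp s \<longrightarrow> exp ((1 - T powr (-1/8)) * ((T / t) * (L t - \<bar>L 0\<bar>))) \<le> norm (f z))"
      unfolding \<eta>_def X_def .
  qed
qed

end

subsection \<open>Size of the Fatou components\<close>

context regular_growth
begin

text \<open>\<open>exp ((L ^^ n) t)\<close> bounds the \<open>n\<close>-th iterates from above, whereas \<open>f ^^ n\<close> maps some point of a
  connected set to modulus at least \<open>exp (l n * (L ^^ Suc n) t)\<close> with \<open>l n = 2 + 2 / 2 ^ n\<close>: the errors
  of the minimum modulus estimate are summable, so that \<open>l n\<close> stays above 2.\<close>
lemma fatou_component_bound:
  assumes ord: "\<And>t. t \<ge> t1 \<Longrightarrow> L t \<le> exp (t / 2)"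
  obtains t0 where "\<And>U t w z. U \<in> components (fatou_set f) \<Longrightarrow> w \<in> U \<Longrightarrow> z \<in> U \<Longrightarrow> t \<ge> t0 \<Longrightarrow>
     norm w \<le> exp t \<Longrightarrow> norm z < exp (exp t)"
proof -
  obtain T0 where step:
    "\<And>T t. T \<ge> T0 \<Longrightarrow> 1 \<le> t \<Longrightarrow> t \<le> T / 2 \<Longrightarrow> \<bar>L 0\<bar> \<le> L t \<Longrightarrow>
      \<exists>s. T / 2 \<le> s \<and> s \<le> T \<and>
        (\<forall>z. norm z = exp s \<longrightarrow> exp ((1 - T powr (-1/8)) * ((T / t) * (L t - \<bar>L 0\<bar>))) \<le> norm (f z))"
    by (rule minimum_modulus_convex) (rule that)
  \<comment> \<open>The number 256 is the eighth power of 2: with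
    \<open>a n \<ge> 256 ^ n * t\<close> the error \<open>T powr (-1/8)\<close> decays like
    \<open>1 / 2 ^ n\<close>. The entries \<open>8 ^ 8\<close> and
    \<open>8 * \<bar>L 0\<bar>\<close> of \<open>t0\<close> bring both relative errors down to
    \<open>1 / (8 * 2 ^ n)\<close>.\<close>
  obtain ta where ta: "\<And>t. t \<ge> ta \<Longrightarrow> L t \<ge> 256 * t" using L_superlinear by blast
  define t0 where "t0 = Max {T0, ta, t1, 8 ^ 8, 8 * \<bar>L 0\<bar>}"
  show ?thesis
  proof (rule that[of t0], rule ccontr)
    fix U t w z
    assume U: "U \<in> components (fatou_set f)" "w \<in> U" "z \<in> U" and "t \<ge> t0"
      and w: "norm w \<le> exp t" and "\<not> norm z < exp (exp t)"
    then have z: "norm z \<ge> exp (exp t)" by simp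
    have t: "t \<ge> T0" "t \<ge> ta" "t \<ge> t1" "t \<ge> 8 ^ 8" "t \<ge> 8 * \<bar>L 0\<bar>"
      using \<open>t \<ge> t0\<close> unfolding t0_def by auto
    have t8: "t \<ge> 8" using t(4) by simp
    have "open U" "connected U"
      using U(1) open_components[OF open_fatou_set] in_components_connected by auto
    then have "path_connected U" by (simp add: connected_open_path_connected)
    then obtain g where g: "path g" "path_image g \<subseteq> U" "pathstart g = w" "pathfinish g = z"
      using U unfolding path_connected_def by blast
    define K where "K = path_image g"
    have K: "compact K" "connected K" "K \<subseteq> U" "w \<in> K" "z \<in> K"
      using g pathstart_in_path_image[of g] pathfinish_in_path_image[of g]
      by (auto simp: K_def compact_path_image connected_path_image)
    define a where "a n = (L ^^ n) t" for n
    have aS: "a (Suc n) = L (a n)" for n by (simp add: a_def)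
    have a_ge: "a n \<ge> 256 ^ n * t" for n
    proof (induction n)
      case (Suc n)
      have "1 * t \<le> 256 ^ n * t" using t8 by (intro mult_right_mono) auto
      then have "a n \<ge> ta" using Suc t by linarith
      then have "L (a n) \<ge> 256 * a n" by (rule ta)
      then show ?case using Suc by (simp add: aS)
    qed (simp add: a_def)
    have a_t: "a n \<ge> t" for n
    proof -
      have "1 * t \<le> 256 ^ n * t" using t8 by (intro mult_right_mono) auto
      then show ?thesis using a_ge[of n] by linarith
    qed
    have a_mono: "a n \<le> a (Suc n)" for n
      using ta[of "a n"] a_t[of n] t t8 unfolding aS by linarith
    have wn: "norm ((f ^^ n) w) \<le> exp (a n)" for n
    proof (induction n)
      case 0
      then show ?case using w by (simp add: a_def)
    next
      case (Suc n)
      then show ?case using norm_le_exp_L by (simp add: aS)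
    qed
    define l :: "nat \<Rightarrow> real" where "l n = 2 + 2 / 2 ^ n" for n
    have l: "2 \<le> l n" "l n \<le> 4" for n by (auto simp: l_def field_simps)
    have grow: "\<exists>x\<in>K. norm ((f ^^ n) x) \<ge> exp (l n * a (Suc n))" for n
    proof (induction n)
      case 0
      \<comment> \<open>Since \<open>l 0 = 4\<close>, the start requires
        \<open>4 * L t \<le> exp t\<close>: one factor \<open>exp (t / 2)\<close> absorbs
        \<open>L t\<close> by \<open>ord\<close>, the other absorbs the 4.\<close>
      have "4 * L t \<le> exp (t / 2) * exp (t / 2)"
      proof (rule mult_mono)
        show "4 \<le> exp (t / 2)" using exp_ge_add_one_self[of "t / 2"] t8 by linarith
        show "L t \<le> exp (t / 2)" by (rule ord) (rule t)
        show "0 \<le> L t" using ta[OF t(2)] t8 by linarith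
      qed auto
      also have "\<dots> = exp t" by (simp add: exp_add[symmetric])
      finally have "exp (l 0 * a (Suc 0)) \<le> exp (exp t)" by (simp add: l_def a_def)
      also have "\<dots> \<le> norm z" by (rule z)
      finally show ?case using K by (intro bexI[of _ z]) auto
    next
      case (Suc n)
      then obtain x where x: "x \<in> K" "norm ((f ^^ n) x) \<ge> exp (l n * a (Suc n))" by blast
      define T where "T = l n * a (Suc n)"
      have apos: "a (Suc n) > 0" using a_t[of "Suc n"] t8 by linarith
      have T2: "a (Suc n) \<le> T / 2" using l(1)[of n] apos by (simp add: T_def)
      have TT0: "T \<ge> T0" using T2 a_t[of "Suc n"] t t8 by linarith
      have LL: "\<bar>L 0\<bar> \<le> L (a (Suc n))" using a_t[of "Suc (Suc n)"] t unfolding aS by linarith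
      obtain s where s: "T / 2 \<le> s" "s \<le> T" and big:
         "\<And>z. norm z = exp s \<Longrightarrow> exp ((1 - T powr (-1/8)) * ((T / a (Suc n)) * (L (a (Suc n)) - \<bar>L 0\<bar>))) \<le> norm (f z)"
        using step[OF TT0 _ T2 LL] a_t[of "Suc n"] t8 by auto
      \<comment> \<open>Intermediate values: on \<open>K\<close> the modulus of
        \<open>f ^^ n\<close> is at most \<open>exp (a n)\<close> at \<open>w\<close> and at least
        \<open>exp T\<close> at \<open>x\<close>, so \<open>f ^^ n\<close> maps some point of
        \<open>K\<close> to the circle of radius \<open>exp s\<close>, where \<open>f\<close> is
        large.\<close>
      have "connected ((\<lambda>x. norm ((f ^^ n) x)) ` K)"
        using K(2) funpow_holomorphic_UNIV[OF holo, of n]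
        by (intro connected_continuous_image continuous_on_norm)
           (meson holomorphic_on_imp_continuous_on continuous_on_subset top_greatest)
      moreover have "norm ((f ^^ n) w) \<le> exp s" using wn[of n] a_mono[of n] T2 s
        by (smt (verit) exp_le_cancel_iff)
      moreover have "exp s \<le> norm ((f ^^ n) x)" using x s by (smt (verit) T_def exp_le_cancel_iff)
      ultimately have "exp s \<in> (\<lambda>x. norm ((f ^^ n) x)) ` K"
        using K(4) x(1) by (meson connectedD_interval imageI)
      then obtain y where y: "y \<in> K" "norm ((f ^^ n) y) = exp s" by auto
      have "l (Suc n) * a (Suc (Suc n)) \<le> (1 - T powr (-1/8)) * ((T / a (Suc n)) * (L (a (Suc n)) - \<bar>L 0\<bar>))"
      proof -
        define e1 where "e1 = T powr (-1/8)"
        define b where "b = a (Suc (Suc n))"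
        have b: "b \<ge> 256 ^ n * t"
          using a_ge[of n] a_mono[of n] a_mono[of "Suc n"] by (simp add: b_def)
        have bpos: "b > 0" using a_t[of "Suc (Suc n)"] t8 by (simp add: b_def)
        have e1: "e1 \<le> 1 / (8 * 2 ^ n)"
        proof -
          have "(8 * 2 ^ n) ^ 8 = (8::real) ^ 8 * 256 ^ n"
            by (simp add: power_mult_distrib power_mult[symmetric] mult.commute[of n 8] power_mult)
          also have "\<dots> \<le> t * 256 ^ n" using t(4) by (intro mult_right_mono) auto
          also have "\<dots> \<le> T" using a_ge[of n] a_mono[of n] T2 apos by (simp add: mult.commute)
          finally have "T \<ge> (8 * 2 ^ n) ^ 8" .
          then have "T powr (-1/8) \<le> ((8 * 2 ^ n) ^ 8) powr (-1/8)"
            by (intro powr_mono2') auto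
          also have "\<dots> = 1 / (8 * 2 ^ n)"
          proof -
            have root8: "(x ^ 8) powr (-1/8) = 1 / x" if "x > 0" for x :: real
            proof -
              have "x ^ 8 = x powr 8" using that by simp
              then have "(x ^ 8) powr (-1/8) = x powr (-1)" by (simp only: powr_powr) simp
              then show ?thesis using that by (simp add: powr_minus_divide)
            qed
            show ?thesis by (rule root8) simp
          qed
          finally show ?thesis by (simp add: e1_def)
        qed
        have e1p: "e1 \<ge> 0" by (simp add: e1_def)
        have e2: "\<bar>L 0\<bar> \<le> b * (1 / (8 * 2 ^ n))"
        proof -
          have "8 * 2 ^ n * \<bar>L 0\<bar> = 2 ^ n * (8 * \<bar>L 0\<bar>)" by simp
          also have "\<dots> \<le> 256 ^ n * t" using t(5) by (intro mult_mono power_mono) auto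
          also have "\<dots> \<le> b" by (rule b)
          finally show ?thesis by (simp add: field_simps)
        qed
        define Q where "Q = b * (1 / (8 * 2 ^ n))"
        have "b - e1 * b - \<bar>L 0\<bar> \<le> (1 - e1) * (b - \<bar>L 0\<bar>)"
          using e1p by (simp add: algebra_simps)
        moreover have "e1 * b \<le> Q"
          using mult_left_mono[OF e1, of b] bpos by (simp only: Q_def mult.commute[of e1 b] less_imp_le)
        moreover have "\<bar>L 0\<bar> \<le> Q" using e2 by (simp only: Q_def)
        moreover have "b - 2 * Q \<le> Y" if "b - v - u \<le> Y" "v \<le> Q" "u \<le> Q" for u v Y
          using that by linarith
        ultimately have "b - 2 * Q \<le> (1 - e1) * (b - \<bar>L 0\<bar>)" by blast
        moreover have "b - 2 * Q = b * (1 - 1 / (4 * 2 ^ n))" by (simp add: Q_def algebra_simps)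
        ultimately have "b * (1 - 1 / (4 * 2 ^ n)) \<le> (1 - e1) * (b - \<bar>L 0\<bar>)" by (simp only:)
        then have "l n * (b * (1 - 1 / (4 * 2 ^ n))) \<le> l n * ((1 - e1) * (b - \<bar>L 0\<bar>))"
          using l(1)[of n] by (intro mult_left_mono) auto
        \<comment> \<open>With \<open>q = 1 / 2 ^ n\<close> the right-hand side is
          \<open>2 + 3 * q / 2 - q * q / 2\<close>, at least \<open>2 + q\<close> because
          \<open>q \<le> 1\<close>.\<close>
        moreover have "l (Suc n) \<le> l n * (1 - 1 / (4 * 2 ^ n))"
        proof -
          define q where "q = (1::real) / 2 ^ n"
          have q: "0 \<le> q" "q \<le> 1" by (auto simp: q_def)
          have "q * q \<le> q * 1" using q by (intro mult_left_mono)
          then have "2 + q \<le> (2 + 2 * q) * (1 - q / 4)" by (simp add: algebra_simps)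
          moreover have "l n = 2 + 2 * q" "l (Suc n) = 2 + q" "1 / (4 * 2 ^ n) = q / 4"
            by (auto simp: l_def q_def)
          ultimately show ?thesis by (simp only:)
        qed
        then have "l (Suc n) * b \<le> (l n * (1 - 1 / (4 * 2 ^ n))) * b" using bpos by (intro mult_right_mono) auto
        moreover have "(l n * (1 - 1 / (4 * 2 ^ n))) * b = l n * (b * (1 - 1 / (4 * 2 ^ n)))" by (simp only: mult_ac)
        ultimately have "l (Suc n) * b \<le> l n * ((1 - e1) * (b - \<bar>L 0\<bar>))" by linarith
        moreover have "T / a (Suc n) = l n" using apos by (simp add: T_def)
        ultimately show ?thesis unfolding aS[of "Suc n", symmetric] b_def e1_def by (simp only: mult_ac)
      qed
      then have "exp (l (Suc n) * a (Suc (Suc n))) \<le> norm (f ((f ^^ n) y))"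
        using big[OF y(2)] by (meson exp_le_cancel_iff order_trans)
      then show ?case using y(1) by auto
    qed
    obtain C :: real where C: "\<And>n y. n \<ge> 1 \<Longrightarrow> y \<in> K \<Longrightarrow>
       ln (norm ((f ^^ n) y) + 3) \<le> C * ln (norm ((f ^^ n) w) + 3)"
      by (rule fatou_component_harnack[OF holo U(1,2) K(1,3)]) (rule that)
    \<comment> \<open>The Harnack estimate on \<open>K\<close> will give
      \<open>a (Suc n) \<le> \<bar>C\<bar> * a n\<close>; superlinear growth of \<open>L\<close>
      refutes this once \<open>a n\<close> is beyond \<open>tc\<close>.\<close>
    obtain tc where tc: "\<And>t. t \<ge> tc \<Longrightarrow> L t \<ge> (2 * \<bar>C\<bar> + 1) * t" using L_superlinear by blast
    obtain m :: nat where m: "real m \<ge> tc" using real_arch_simple by blast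
    define n where "n = Suc m"
    have "real n \<le> 2 ^ n" using of_nat_less_two_power[of n, where 'a=real] by simp
    moreover have "(2::real) ^ n \<le> 256 ^ n" by (intro power_mono) auto
    moreover have "256 ^ n * 1 \<le> 256 ^ n * t" using t8 by (intro mult_left_mono) auto
    ultimately have "a n \<ge> real n" using a_ge[of n] by linarith
    then have "a n \<ge> tc" using m unfolding n_def by simp
    then have super: "a (Suc n) \<ge> (2 * \<bar>C\<bar> + 1) * a n" unfolding aS by (rule tc)
    obtain y where y: "y \<in> K" "norm ((f ^^ n) y) \<ge> exp (l n * a (Suc n))" using grow by blast
    have an: "a n \<ge> 8" using a_t[of n] t8 by linarith
    have "2 * a (Suc n) \<le> l n * a (Suc n)" using l(1)[of n] a_t[of "Suc n"] t8 by (intro mult_right_mono) auto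
    also have "\<dots> = ln (exp (l n * a (Suc n)))" by simp
    also have "\<dots> \<le> ln (norm ((f ^^ n) y) + 3)" using y(2) by (intro ln_mono) auto
    also have "\<dots> \<le> C * ln (norm ((f ^^ n) w) + 3)" by (rule C) (auto simp: n_def y)
    also have "\<dots> \<le> \<bar>C\<bar> * ln (norm ((f ^^ n) w) + 3)" by (intro mult_right_mono) auto
    also have "\<dots> \<le> \<bar>C\<bar> * (2 * a n)"
    proof (rule mult_left_mono)
      have "ln (norm ((f ^^ n) w) + 3) \<le> ln (exp (a n) * exp (a n))"
      proof (rule ln_mono)
        have "exp (a n) \<ge> 4" using exp_ge_add_one_self[of "a n"] an by linarith
        then have "4 * exp (a n) \<le> exp (a n) * exp (a n)" by (intro mult_right_mono) auto
        then show "norm ((f ^^ n) w) + 3 \<le> exp (a n) * exp (a n)"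
          using wn[of n] \<open>exp (a n) \<ge> 4\<close> by linarith
      qed (auto intro: add_nonneg_pos)
      then show "ln (norm ((f ^^ n) w) + 3) \<le> 2 * a n" by (simp add: exp_add[symmetric])
    qed simp
    finally have "2 * a (Suc n) \<le> \<bar>C\<bar> * (2 * a n)" .
    moreover have "(2 * \<bar>C\<bar> + 1) * a n = 2 * (\<bar>C\<bar> * a n) + a n" by (simp add: algebra_simps)
    moreover have "\<bar>C\<bar> * a n \<ge> 0" using an by simp
    moreover have "\<bar>C\<bar> * (2 * a n) = 2 * (\<bar>C\<bar> * a n)" by simp
    ultimately show False using super an by linarith
  qed
qed

text \<open>In the logarithmic variable the order hypothesis reads
  \<open>ln (L t) / t < 1 / 2\<close> for large \<open>t\<close>; positivity of \<open>L t\<close>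
  allows exponentiating.\<close>

lemma L_le_exp_half:
  assumes "entire_order f < ereal (1 / 2)"
  obtains t1 where "\<And>t. t \<ge> t1 \<Longrightarrow> L t \<le> exp (t / 2)"
proof -
  have "\<forall>\<^sub>F r in at_top. ereal (ln (ln (max_modulus r f)) / ln r) < ereal (1 / 2)"
    using assms unfolding entire_order_def by (rule Limsup_lessD)
  then obtain r0 where r0: "\<And>r. r \<ge> r0 \<Longrightarrow> ln (ln (max_modulus r f)) / ln r < 1 / 2"
    unfolding eventually_at_top_linorder by auto
  show ?thesis
  proof (rule that[of "max (max 1 (ln M1)) (ln (max 1 r0))"])
    fix t assume "t \<ge> max (max 1 (ln M1)) (ln (max 1 r0))"
    then have t: "t \<ge> 1" "t \<ge> ln M1" "t \<ge> ln (max 1 r0)" by auto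
    have "max 1 r0 \<le> exp t" using t(3) by (metis exp_le_cancel_iff exp_ln less_le_trans max.cobounded1 zero_less_one)
    then have "exp t \<ge> r0" by simp
    from r0[OF this] have "ln (L t) / t < 1 / 2" by (simp add: L_def)
    then have "ln (L t) < t / 2" using t by (simp add: field_simps)
    moreover have "L t > 0" by (rule L_pos[OF t(2)])
    ultimately show "L t \<le> exp (t / 2)" by (metis exp_le_cancel_iff exp_ln less_imp_le)
  qed
qed

text \<open>With \<open>t\<close> equal to \<open>ln (norm w + 3)\<close> plus a constant, the
  component bound turns into \<open>ln (ln (norm z + 30)) \<le> C * ln (norm w + 3)\<close> for
  \<open>w\<close> and \<open>z\<close> in one component, with \<open>C\<close> independent of the
  component.\<close>

lemma B2_finite:
  assumes "entire_order f < ereal (1 / 2)"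
  shows "B2 f < \<infinity>"
proof -
  obtain t1 where t1: "\<And>t. t \<ge> t1 \<Longrightarrow> L t \<le> exp (t / 2)"
    by (rule L_le_exp_half[OF assms]) (rule that)
  obtain t0 where t0: "\<And>U t w z. U \<in> components (fatou_set f) \<Longrightarrow> w \<in> U \<Longrightarrow> z \<in> U \<Longrightarrow> t \<ge> t0 \<Longrightarrow>
     norm w \<le> exp t \<Longrightarrow> norm z < exp (exp t)"
    by (rule fatou_component_bound[OF t1]) (assumption, rule that)
  define \<tau> where "\<tau> = max t0 3"
  define C where "C = \<tau> + 2"
  have C: "C > 0" by (simp add: C_def \<tau>_def)
  have main: "ln (ln (norm z + 30)) \<le> C * ln (norm w + 3)"
    if U: "U \<in> components (fatou_set f)" "w \<in> U" "z \<in> U" for U w z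
  proof -
    \<comment> \<open>Adding \<open>\<tau>\<close> ensures \<open>t \<ge> t0\<close> and
      \<open>t \<ge> 4\<close>; the latter makes \<open>exp (exp t)\<close> at least 6, enough to
      absorb the 30 into a square.\<close>
    define t where "t = ln (norm w + 3) + \<tau>"
    have "ln (exp 1) \<le> ln (norm w + 3)" using exp_le by (intro ln_mono) (auto intro: add_increasing)
    then have w1: "ln (norm w + 3) \<ge> 1" by simp
    have w3: "norm w + 3 > 0" by (simp add: add_nonneg_pos)
    have "exp (ln (norm w + 3)) \<le> exp t" by (simp add: t_def \<tau>_def)
    then have "norm w \<le> exp t" using w3 by simp
    moreover have tge: "t \<ge> t0" "t \<ge> 4" using w1 by (auto simp: t_def \<tau>_def)
    ultimately have z: "norm z < exp (exp t)" using t0[OF U] by blast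
    have et: "exp t \<ge> 5" using exp_ge_add_one_self[of t] tge by linarith
    have eet: "exp (exp t) \<ge> 6" using exp_ge_add_one_self[of "exp t"] et by linarith
    have "norm z + 30 \<le> exp (exp t) * exp (exp t)"
    proof -
      have "6 * exp (exp t) \<le> exp (exp t) * exp (exp t)" using eet by (intro mult_right_mono) auto
      then show ?thesis using z eet by linarith
    qed
    also have "\<dots> = exp (2 * exp t)" by (simp add: exp_add[symmetric])
    finally have "ln (norm z + 30) \<le> ln (exp (2 * exp t))"
      by (intro ln_mono) (auto intro: add_nonneg_pos)
    also have "\<dots> \<le> exp 1 * exp t" using exp_ge_add_one_self[of 1] by simp
    also have "\<dots> = exp (t + 1)" by (simp add: exp_add)
    finally have "ln (norm z + 30) \<le> exp (t + 1)" .
    moreover have "ln (norm z + 30) > 0" using norm_ge_zero[of z] by (intro ln_gt_zero) linarith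
    ultimately have "ln (ln (norm z + 30)) \<le> t + 1" by (metis ln_exp ln_mono)
    also have "\<dots> = ln (norm w + 3) + (\<tau> + 1)" by (simp add: t_def)
    also have "\<dots> \<le> ln (norm w + 3) + (\<tau> + 1) * ln (norm w + 3)"
    proof -
      have "(\<tau> + 1) * 1 \<le> (\<tau> + 1) * ln (norm w + 3)"
        using w1 by (intro mult_left_mono) (auto simp: \<tau>_def)
      then show ?thesis by simp
    qed
    also have "\<dots> = C * ln (norm w + 3)" by (simp add: C_def algebra_simps)
    finally show ?thesis .
  qed
  have "B2_term U \<le> ereal C" if U: "U \<in> components (fatou_set f)" for U
  proof -
    obtain w where w: "w \<in> U" using U in_components_nonempty by blast
    define I where "I = (INF w\<in>U. ereal (ln (norm w + 3)))"
    have "ereal (ln 3) \<le> I" unfolding I_def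
      by (intro INF_greatest) (simp add: add_nonneg_pos)
    moreover have "I \<le> ereal (ln (norm w + 3))" unfolding I_def using w by (rule INF_lower)
    ultimately obtain i where i: "I = ereal i" "ln 3 \<le> i" by (cases I) auto
    have i0: "i > 0" using i(2) ln_gt_zero[of "3::real"] by linarith
    have "(SUP z\<in>U. ereal (ln (ln (norm z + 30)))) \<le> ereal (C * i)"
    proof (rule SUP_least)
      fix z assume z: "z \<in> U"
      have "ereal (ln (ln (norm z + 30)) / C) \<le> I" unfolding I_def
        using main[OF U _ z] C by (intro INF_greatest) (simp add: field_simps)
      then show "ereal (ln (ln (norm z + 30))) \<le> ereal (C * i)" using C by (simp add: i(1) field_simps)
    qed
    then have "B2_term U \<le> ereal (C * i) / ereal i"
      unfolding B2_term_def I_def[symmetric] i(1) using i0 by (intro ereal_divide_right_mono) auto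
    also have "\<dots> = ereal C" using i0 by simp
    finally show ?thesis .
  qed
  then have "B2 f \<le> ereal C" unfolding B2_def by (rule SUP_least)
  then show ?thesis by (meson ereal_less_PInfty le_less_trans less_ereal.simps(4))
qed

end

theorem theorem3:
  fixes f :: "complex \<Rightarrow> complex" and M1 D1 D2 :: real
  assumes "transcendental_entire f"
    and "fatou_set f \<noteq> {}"
    and "entire_order f < ereal (1 / 2)"
    and "M1 > 0" and "D1 > 1" and "D2 > 1" and "D1 > D2\<^sup>2"
    and "{M1..} \<subseteq> {r. r > 0 \<and> ln (max_modulus (D1 * r) f) < D2 * ln (max_modulus r f)}"
  shows "B2 f < \<infinity>"
proof -
  interpret regular_growth f M1 D1 D2
    using assms by unfold_locales auto
  show ?thesis using assms(3) by (rule B2_finite)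
qed

end
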